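(* Let $(\phi(t))_{t\ge0}$ be the winding number process of the Brownian motion on $\mathbb{CH}^1$ started at Riemannian distance $r_0\in(0,\infty)$ from $0$. When $t\to\infty$, in distribution we have $$\phi(t)\to\mathcal{C}_{\ln\coth r_0},$$ where $\mathcal{C}_{\ln\coth r_0}$ is a Cauchy distribution with parameter $\ln\coth r_0$.
   Context: $\mathbb{CH}^1$ is isometric to the two-dimensional hyperbolic space (with the normalization fixed by the following generator). In spherical coordinates $(r,\phi)$, where $r\in[0,\infty)$ is the Riemannian distance from $0$ and $\phi$ is the angular coordinate around $0$, the generator of Brownian motion on $\mathbb{CH}^1$ is $$\frac12\left(\frac{\partial^2}{\partial r^2}+2\coth2r\,\frac{\partial}{\partial r}+\frac{4}{\sinh^22r}\frac{\partial^2}{\partial\phi^2}\right).$$ The winding number process (the continuous real-valued determination, starting at $0$, of the angle wound around $0$ by the Brownian motion) is given by $$\phi(t)=\beta_{\int_0^t\frac{4\,ds}{\sinh^22r(s)}},$$ where $r(t)$ is the hyperbolic Jacobi diffusion started at $r_0\in(0,\infty)$ with generator $\frac12\left(\frac{\partial^2}{\partial r^2}+2\coth2r\,\frac{\partial}{\partial r}\right)$ and $\beta$ is a standard real Brownian motion independent from $r$. The Cauchy distribution with parameter $a>0$ is the law on $\mathbb{R}$ with characteristic function $\lambda\mapsto e^{-a|\lambda|}$. *)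

theory Defs
  imports "HOL-Probability.Probability"
begin

definition coth :: "real \<Rightarrow> real" where
  "coth x = cosh x / sinh x"

text \<open>Stochastic processes are functions of type \<open>real \<Rightarrow> 'a \<Rightarrow> real\<close>; only the
  values at times \<open>t \<ge> 0\<close> are relevant.\<close>

definition continuous_process :: "'a measure \<Rightarrow> (real \<Rightarrow> 'a \<Rightarrow> real) \<Rightarrow> bool" where
  "continuous_process M X \<longleftrightarrow>
     (\<forall>t\<ge>0. X t \<in> borel_measurable M) \<and>
     (\<forall>\<omega>\<in>space M. continuous_on {0..} (\<lambda>t. X t \<omega>))"

definition natural_filtration ::
  "'a measure \<Rightarrow> (real \<Rightarrow> 'a \<Rightarrow> real) \<Rightarrow> real \<Rightarrow> 'a measure" where
  "natural_filtration M X s =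
     sigma (space M) (\<Union>u\<in>{0..s}. {X u -` B \<inter> space M | B. B \<in> sets borel})"

definition martingale_wrt ::
  "'a measure \<Rightarrow> (real \<Rightarrow> 'a measure) \<Rightarrow> (real \<Rightarrow> 'a \<Rightarrow> real) \<Rightarrow> bool" where
  "martingale_wrt M F X \<longleftrightarrow>
     (\<forall>t\<ge>0. integrable M (X t) \<and> X t \<in> borel_measurable (F t)) \<and>
     (\<forall>s t. 0 \<le> s \<and> s \<le> t \<longrightarrow> (AE \<omega> in M. real_cond_exp M (F s) (X t) \<omega> = X s \<omega>))"

text \<open>The functions of class \<open>C\<^sup>2\<close> with compact support in the open half-line.\<close>

definition C2_compact_support_pos :: "(real \<Rightarrow> real) set" where
  "C2_compact_support_pos =
     {f. (\<forall>x. f differentiable (at x)) \<and> (\<forall>x. deriv f differentiable (at x)) \<and>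
         continuous_on UNIV (deriv (deriv f)) \<and>
         (\<exists>a b. 0 < a \<and> (\<forall>x. x \<notin> {a..b} \<longrightarrow> f x = 0))}"

definition hyperbolic_jacobi_generator :: "(real \<Rightarrow> real) \<Rightarrow> real \<Rightarrow> real" where
  "hyperbolic_jacobi_generator f x =
     (1/2) * (deriv (deriv f) x + 2 * coth (2 * x) * deriv f x)"

text \<open>A diffusion with a given generator is understood in the sense of the martingale
  problem. The drift is singular at \<open>0\<close>, which the diffusion never reaches from
  \<open>r0 > 0\<close>, so the state space is the open half-line.\<close>

definition hyperbolic_jacobi_diffusion ::
  "'a measure \<Rightarrow> real \<Rightarrow> (real \<Rightarrow> 'a \<Rightarrow> real) \<Rightarrow> bool" where
  "hyperbolic_jacobi_diffusion M r0 r \<longleftrightarrow>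
     continuous_process M r \<and>
     (\<forall>\<omega>\<in>space M. r 0 \<omega> = r0 \<and> (\<forall>t\<ge>0. r t \<omega> > 0)) \<and>
     (\<forall>f\<in>C2_compact_support_pos.
        martingale_wrt M (natural_filtration M r)
          (\<lambda>t \<omega>. f (r t \<omega>) - f r0 -
             (LBINT s:{0..t}. hyperbolic_jacobi_generator f (r s \<omega>))))"

definition standard_brownian_motion :: "'a measure \<Rightarrow> (real \<Rightarrow> 'a \<Rightarrow> real) \<Rightarrow> bool" where
  "standard_brownian_motion M B \<longleftrightarrow>
     continuous_process M B \<and>
     (\<forall>\<omega>\<in>space M. B 0 \<omega> = 0) \<and>
     (\<forall>s t. 0 \<le> s \<and> s < t \<longrightarrow>
        distributed M lborel (\<lambda>\<omega>. B t \<omega> - B s \<omega>) (normal_density 0 (sqrt (t - s)))) \<and>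
     (\<forall>(\<tau>::nat \<Rightarrow> real) n. 0 \<le> \<tau> 0 \<and> mono \<tau> \<longrightarrow>
        prob_space.indep_vars M (\<lambda>_. borel) (\<lambda>i \<omega>. B (\<tau> (Suc i)) \<omega> - B (\<tau> i) \<omega>) {..<n})"

text \<open>Independence of the whole processes, as random elements of \<open>\<real>\<close> to the power
  \<open>[0,\<infinity>)\<close> with the product sigma-algebra.\<close>

definition independent_processes ::
  "'a measure \<Rightarrow> (real \<Rightarrow> 'a \<Rightarrow> real) \<Rightarrow> (real \<Rightarrow> 'a \<Rightarrow> real) \<Rightarrow> bool" where
  "independent_processes M X Y \<longleftrightarrow>
     prob_space.indep_var M
       (\<Pi>\<^sub>M t\<in>{0..}. borel) (\<lambda>\<omega>. \<lambda>t\<in>{0..}. X t \<omega>)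
       (\<Pi>\<^sub>M t\<in>{0..}. borel) (\<lambda>\<omega>. \<lambda>t\<in>{0..}. Y t \<omega>)"

definition winding_clock :: "(real \<Rightarrow> 'a \<Rightarrow> real) \<Rightarrow> real \<Rightarrow> 'a \<Rightarrow> real" where
  "winding_clock r t \<omega> = (LBINT s:{0..t}. 4 / (sinh (2 * r s \<omega>))\<^sup>2)"

text \<open>The winding number around \<open>0\<close> of the Brownian motion on \<open>\<complex>H\<^sup>1\<close> with radial part
  \<open>r\<close>: the angular part of the generator is \<open>(1/2) (4 / sinh\<^sup>2 (2 r)) \<partial>\<^sup>2/\<partial>\<phi>\<^sup>2\<close>, so the angle is
  the independent Brownian motion \<open>\<beta>\<close> run with the clock above.\<close>

definition CH1_winding ::
  "(real \<Rightarrow> 'a \<Rightarrow> real) \<Rightarrow> (real \<Rightarrow> 'a \<Rightarrow> real) \<Rightarrow> real \<Rightarrow> 'a \<Rightarrow> real" where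
  "CH1_winding r \<beta> t \<omega> = \<beta> (winding_clock r t \<omega>) \<omega>"

text \<open>Given by its characteristic function, which determines it by \<open>Levy_uniqueness\<close>.\<close>

definition cauchy_distribution :: "real \<Rightarrow> real measure" where
  "cauchy_distribution a =
     (THE \<mu>. real_distribution \<mu> \<and> (\<forall>u. char \<mu> u = of_real (exp (- (a * \<bar>u\<bar>)))))"

text \<open>Weak convergence as in \<^const>\<open>weak_conv_m\<close>, for a family indexed by real times
  tending to infinity.\<close>

definition weak_conv_at_top :: "(real \<Rightarrow> real measure) \<Rightarrow> real measure \<Rightarrow> bool" where
  "weak_conv_at_top \<mu> \<nu> \<longleftrightarrow>
     (\<forall>x. isCont (cdf \<nu>) x \<longrightarrow> ((\<lambda>t. cdf (\<mu> t) x) \<longlongrightarrow> cdf \<nu> x) at_top)"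

lemma weak_conv_at_top_iff_sequences:
  "weak_conv_at_top \<mu> \<nu> \<longleftrightarrow>
     (\<forall>T. filterlim T at_top sequentially \<longrightarrow> weak_conv_m (\<lambda>n. \<mu> (T n)) \<nu>)"
proof
  assume L: "weak_conv_at_top \<mu> \<nu>"
  show "\<forall>T. filterlim T at_top sequentially \<longrightarrow> weak_conv_m (\<lambda>n. \<mu> (T n)) \<nu>"
    unfolding weak_conv_m_def weak_conv_def
  proof (intro allI impI)
    fix T :: "nat \<Rightarrow> real" and x
    assume T: "filterlim T at_top sequentially" and x: "isCont (cdf \<nu>) x"
    have "((\<lambda>t. cdf (\<mu> t) x) \<longlongrightarrow> cdf \<nu> x) at_top"
      using L x unfolding weak_conv_at_top_def by simp
    from filterlim_compose[OF this T] show "(\<lambda>n. cdf (\<mu> (T n)) x) \<longlonglongrightarrow> cdf \<nu> x" .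
  qed
next
  assume R: "\<forall>T. filterlim T at_top sequentially \<longrightarrow> weak_conv_m (\<lambda>n. \<mu> (T n)) \<nu>"
  show "weak_conv_at_top \<mu> \<nu>"
    unfolding weak_conv_at_top_def
  proof (intro allI impI)
    fix x assume x: "isCont (cdf \<nu>) x"
    show "((\<lambda>t. cdf (\<mu> t) x) \<longlongrightarrow> cdf \<nu> x) at_top"
    proof (rule tendsto_at_topI_sequentially)
      fix T :: "nat \<Rightarrow> real"
      assume "filterlim T at_top sequentially"
      with R have "weak_conv_m (\<lambda>n. \<mu> (T n)) \<nu>" by simp
      with x show "(\<lambda>n. cdf (\<mu> (T n)) x) \<longlonglongrightarrow> cdf \<nu> x"
        unfolding weak_conv_m_def weak_conv_def by simp
    qed
  qed
qed

end

theory Submission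
  imports Defs
begin

text \<open>The function \<open>ln coth\<close> is harmonic for the hyperbolic Jacobi generator. In the coordinate
  \<open>W = ln (coth r)\<close> the generator becomes \<open>2 sinh\<^sup>2 w \<partial>\<^sup>2/\<partial>w\<^sup>2\<close>, and the speed \<open>4 / sinh\<^sup>2 (2 r)\<close> of the
  winding clock \<open>A\<close> becomes \<open>4 sinh\<^sup>2 w\<close>. So \<open>W\<close> and the winding number \<open>\<phi>\<close> are two independent Brownian
  motions run with one and the same clock \<open>A\<close>, and the limit of \<open>\<phi>\<close> is the ordinate at which a planar
  Brownian motion started at \<open>(ln (coth r0), 0)\<close> meets the line \<open>w = 0\<close>. That ordinate has a Cauchy law.

  Quantitatively, \<open>\<beta>\<close> is independent of \<open>A\<close>, so the characteristic function of \<open>\<phi> t\<close> at \<open>u\<close> is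
  \<open>E exp (- u\<^sup>2 A t / 2)\<close> (\<open>time_change_char\<close>), and the claim is that for \<open>l > 0\<close> this Laplace transform
  tends to \<open>exp (- l ln (coth r0))\<close> (\<open>laplace_limit\<close>). Since \<open>exp (- l w)\<close> satisfies
  \<open>2 sinh\<^sup>2 w k'' = (l\<^sup>2 / 2) 4 sinh\<^sup>2 w k\<close>, the process \<open>exp (- l W t - l\<^sup>2 A t / 2)\<close> ought to be a martingale.
  The martingale problem however speaks only about test functions with compact support in
  \<open>0 < w < \<infinity>\<close>, and both ends need an argument.

  \<^item> Near \<open>w = 0\<close>, that is \<open>r = \<infinity>\<close>, a cut-off at scale \<open>1/m\<close> has second derivative of order \<open>m\<^sup>2\<close> where
    \<open>sinh\<^sup>2 w\<close> is of order \<open>1/m\<^sup>2\<close>. It disappears by dominated convergence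
    (\<open>dynkin_pair_const_at_infinity\<close>).
  \<^item> Near \<open>w = \<infinity>\<close>, that is \<open>r = 0\<close>, the coefficient \<open>sinh\<^sup>2 w\<close> explodes and the error made by a cut-off is
    not bounded. But a function that is constant for large \<open>w\<close> is a constant plus a compactly
    supported function, hence admissible. The function \<open>exp (- l w)\<close> is a limit of subsolutions that
    vanish for large \<open>w\<close> and of supersolutions that are constant for large \<open>w\<close>. With the discount
    factor \<open>exp (- l\<^sup>2 A t / 2)\<close> they give expectations that increase and decrease with \<open>t\<close>
    (\<open>feynman_kac\<close>, \<open>discounted_subsolution\<close>, \<open>discounted_supersolution\<close>).

  It remains to replace \<open>E (exp (- l W t) D t)\<close> by \<open>E (D t)\<close>, where \<open>D\<close> is the discount factor. The
  difference \<open>1 - exp (- l w)\<close> is at most a small constant plus a multiple of the speed of the clock,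
  and the integral over all times of speed times discount is bounded because it integrates the
  derivative of \<open>- D\<close>.

  The Cauchy law is produced by the process itself. The lower bound
  \<open>exp (- l ln (coth r0)) \<le> E exp (- l\<^sup>2 A t / 2)\<close> with \<open>l\<close> tending to \<open>0\<close> shows that \<open>A\<close> stays bounded almost
  surely, so \<open>\<phi>\<close> converges almost surely along the integers; the limit variable has the
  characteristic function \<open>exp (- ln (coth r0) \<bar>u\<bar>)\<close>, and the Levy theorems conclude.\<close>

section \<open>Twice differentiable truncations\<close>

lemma DERIV_pos_part_power:
  fixes x :: real
  shows "((\<lambda>x. (max 0 x) ^ Suc (Suc n)) has_real_derivative real (Suc (Suc n)) * (max 0 x) ^ Suc n) (at x)"
proof -
  consider "x > 0" | "x < 0" | "x = 0" by linarith
  then show ?thesis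
  proof cases
    case 1
    have "((\<lambda>x. x ^ Suc (Suc n)) has_real_derivative real (Suc (Suc n)) * (max 0 x) ^ Suc n) (at x)"
      using 1 DERIV_pow[of "Suc (Suc n)" x] by (simp add: max_def)
    then show ?thesis
      by (rule has_field_derivative_transform_within_open[of _ _ _ "{0<..}"]) (use 1 in auto)
  next
    case 2
    have "((\<lambda>x. 0) has_real_derivative real (Suc (Suc n)) * (max 0 x) ^ Suc n) (at x)"
      using 2 by (auto intro!: derivative_eq_intros)
    then show ?thesis
      by (rule has_field_derivative_transform_within_open[of _ _ _ "{..<0}"]) (use 2 in auto)
  next
    case 3
    have "(\<lambda>h::real. (max 0 h) ^ Suc (Suc n) / h) \<midarrow>0\<rightarrow> 0"
    proof (rule Lim_null_comparison)
      show "\<forall>\<^sub>F h::real in at 0. norm ((max 0 h) ^ Suc (Suc n) / h) \<le> \<bar>h\<bar> ^ Suc n"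
      proof (intro always_eventually allI)
        show "norm ((max 0 h) ^ Suc (Suc n) / h) \<le> \<bar>h\<bar> ^ Suc n" for h :: real
        proof (cases "h > 0")
          case False
          then have "max 0 h = 0" by simp
          then show ?thesis using zero_le_power[of "\<bar>h\<bar>" "Suc n"] by (simp del: power_Suc)
        qed (simp add: max_absorb2)
      qed
      show "(\<lambda>h::real. \<bar>h\<bar> ^ Suc n) \<midarrow>0\<rightarrow> 0"
        by (auto intro!: tendsto_eq_intros)
    qed
    then show ?thesis using 3 by (simp add: DERIV_def)
  qed
qed

text \<open>A cube is the lowest power of the positive part that is twice continuously differentiable. All
  truncations below are composed of this function.\<close>

definition pos_cube :: "real \<Rightarrow> real" where
  "pos_cube x = (max 0 x) ^ 3"

lemma pos_cube_DERIV: "(pos_cube has_real_derivative 3 * (max 0 x)\<^sup>2) (at x)"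
  using DERIV_pos_part_power[of 1 x] unfolding pos_cube_def
  by (simp add: numeral_eq_Suc)

lemma pos_square_DERIV: "((\<lambda>x. 3 * (max 0 x)\<^sup>2) has_real_derivative 6 * max 0 x) (at x)"
  using DERIV_cmult[OF DERIV_pos_part_power[of 0 x], of 3]
  by (simp add: numeral_eq_Suc algebra_simps)

definition C2_with :: "(real \<Rightarrow> real) \<Rightarrow> (real \<Rightarrow> real) \<Rightarrow> (real \<Rightarrow> real) \<Rightarrow> bool" where
  "C2_with f f' f'' \<longleftrightarrow>
     (\<forall>x. (f has_real_derivative f' x) (at x)) \<and>
     (\<forall>x. (f' has_real_derivative f'' x) (at x)) \<and> continuous_on UNIV f''"

lemma C2_withD:
  assumes "C2_with f f' f''"
  shows "(f has_real_derivative f' x) (at x)" "(f' has_real_derivative f'' x) (at x)"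
    "continuous_on UNIV f''" "continuous_on UNIV f'" "continuous_on UNIV f"
  using assms unfolding C2_with_def
  by (auto intro!: continuous_at_imp_continuous_on intro: DERIV_isCont)

lemma C2_with_mult:
  assumes "C2_with f f' f''" "C2_with g g' g''"
  shows "C2_with (\<lambda>x. f x * g x) (\<lambda>x. f' x * g x + f x * g' x)
           (\<lambda>x. f'' x * g x + 2 * f' x * g' x + f x * g'' x)"
  unfolding C2_with_def using C2_withD[OF assms(1)] C2_withD[OF assms(2)]
  by (auto intro!: derivative_eq_intros continuous_intros simp: algebra_simps)

lemma C2_with_compose:
  assumes "C2_with f f' f''" "C2_with g g' g''"
  shows "C2_with (\<lambda>x. f (g x)) (\<lambda>x. f' (g x) * g' x)
           (\<lambda>x. f'' (g x) * (g' x)\<^sup>2 + f' (g x) * g'' x)"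
proof -
  note [derivative_intros] = DERIV_chain2[OF C2_withD(1)[OF assms(1)] C2_withD(1)[OF assms(2)]]
    DERIV_chain2[OF C2_withD(2)[OF assms(1)] C2_withD(1)[OF assms(2)]] C2_withD(2)[OF assms(2)]
  note c = continuous_on_compose2[OF _ _ subset_UNIV]
  show ?thesis
    unfolding C2_with_def using C2_withD[OF assms(1)] C2_withD[OF assms(2)]
    by (auto intro!: derivative_eq_intros continuous_intros intro: c simp: power2_eq_square algebra_simps)
qed

lemma C2_with_affine: "C2_with (\<lambda>x. a + b * x) (\<lambda>x. b) (\<lambda>x. 0)"
  unfolding C2_with_def by (auto intro!: derivative_eq_intros)

lemma C2_with_exp: "C2_with (\<lambda>x. exp (a * x)) (\<lambda>x. a * exp (a * x)) (\<lambda>x. a\<^sup>2 * exp (a * x))"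
  unfolding C2_with_def by (auto intro!: derivative_eq_intros continuous_intros simp: power2_eq_square)

lemma C2_with_pos_cube: "C2_with pos_cube (\<lambda>x. 3 * (max 0 x)\<^sup>2) (\<lambda>x. 6 * max 0 x)"
  unfolding C2_with_def using pos_cube_DERIV pos_square_DERIV
  by (auto intro!: continuous_intros)

lemma C2_with_cong:
  assumes "C2_with f f' f''" "\<And>x. f x = g x" "\<And>x. f' x = g' x" "\<And>x. f'' x = g'' x"
  shows "C2_with g g' g''"
proof -
  have "f = g" "f' = g'" "f'' = g''" using assms by auto
  then show ?thesis using assms(1) by simp
qed

lemma C2_with_const_on_open:
  assumes "C2_with f f' f''" "open S" "\<And>x. x \<in> S \<Longrightarrow> f x = c" "x \<in> S"
  shows "f' x = 0" "f'' x = 0"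
proof -
  have f': "f' y = 0" if y: "y \<in> S" for y
  proof -
    have "((\<lambda>x. c) has_real_derivative f' y) (at y)"
      by (rule has_field_derivative_transform_within_open[OF C2_withD(1)[OF assms(1)] assms(2)])
        (use y assms(3) in auto)
    then show ?thesis using DERIV_const DERIV_unique by blast
  qed
  then show "f' x = 0" using assms(4) .
  have "((\<lambda>x. 0) has_real_derivative f'' x) (at x)"
    by (rule has_field_derivative_transform_within_open[OF C2_withD(2)[OF assms(1)] assms(2)])
      (use assms(4) f' in auto)
  then show "f'' x = 0" using DERIV_const DERIV_unique by blast
qed

section \<open>The harmonic coordinate\<close>

lemma coth_gt_1: "0 < x \<Longrightarrow> 1 < coth x"
  unfolding coth_def by (simp add: sinh_less_cosh_real)

lemma ln_coth_pos: "0 < x \<Longrightarrow> 0 < ln (coth x)"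
  using coth_gt_1[of x] by simp

lemma ln_coth_eq: "0 < x \<Longrightarrow> ln (coth x) = - ln (tanh x)"
  unfolding coth_def tanh_def by (simp add: ln_div)

lemma DERIV_ln_coth:
  assumes "0 < x"
  shows "((\<lambda>x. ln (coth x)) has_real_derivative - 2 / sinh (2 * x)) (at x)"
proof -
  have p: "sinh x > 0" "cosh x > 0" using assms by auto
  have "((\<lambda>x. ln (cosh x / sinh x)) has_real_derivative
      ((sinh x * sinh x - cosh x * cosh x) / (sinh x * sinh x)) / (cosh x / sinh x)) (at x)"
    using p by (auto intro!: derivative_eq_intros simp: divide_simps)
  also have "((sinh x * sinh x - cosh x * cosh x) / (sinh x * sinh x)) / (cosh x / sinh x)
      = - 2 / sinh (2 * x)"
    using p cosh_square_eq[of x] unfolding sinh_double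
    by (simp add: divide_simps power2_eq_square)
  finally show ?thesis unfolding coth_def .
qed

lemma DERIV_ln_coth':
  assumes "0 < (x::real)"
  shows "((\<lambda>x. - 2 / sinh (2 * x)) has_real_derivative 4 * cosh (2 * x) / (sinh (2 * x))\<^sup>2) (at x)"
  using assms by (auto intro!: derivative_eq_intros simp: power2_eq_square divide_simps)

lemma sinh_ln_coth:
  assumes "0 < x"
  shows "sinh (ln (coth x)) = 1 / sinh (2 * x)"
proof -
  have p: "sinh x > 0" "cosh x > 0" using assms by auto
  have "sinh (ln (coth x)) = (coth x - inverse (coth x)) / 2"
    using coth_gt_1[OF assms] by (simp add: sinh_ln_real)
  also have "\<dots> = 1 / sinh (2 * x)"
    using p cosh_square_eq[of x] unfolding sinh_double coth_def
    by (simp add: divide_simps power2_eq_square)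
  finally show ?thesis .
qed

lemma ln_coth_compact_range:
  assumes "0 < a"
  obtains p q where "0 < p" "\<And>x. 0 < x \<Longrightarrow> x < p \<Longrightarrow> b < ln (coth x)"
    "\<And>x. 0 < x \<Longrightarrow> q < x \<Longrightarrow> ln (coth x) < a"
proof -
  have "(tanh \<longlongrightarrow> tanh 0) (at (0::real))"
    using isCont_tanh[of "0::real"] by (simp add: isCont_def)
  then have "\<forall>\<^sub>F x in at (0::real). tanh x < exp (- b)"
    by (rule order_tendstoD) simp
  then obtain p where p: "0 < p" "\<And>x. x \<noteq> 0 \<Longrightarrow> \<bar>x\<bar> < p \<Longrightarrow> tanh x < exp (- b)"
    unfolding eventually_at by (auto simp: dist_real_def)
  have "\<forall>\<^sub>F x in at_top. tanh (x::real) > exp (- a)"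
    using tanh_real_at_top by (rule order_tendstoD) (use assms in simp)
  then obtain q where q: "\<And>x. q \<le> x \<Longrightarrow> tanh x > exp (- a)"
    unfolding eventually_at_top_linorder by auto
  show ?thesis
  proof (rule that[of p q])
    show "b < ln (coth x)" if "0 < x" "x < p" for x
    proof -
      have "ln (tanh x) < ln (exp (- b))"
        using p(2)[of x] that by (subst ln_less_cancel_iff) auto
      then show ?thesis using ln_coth_eq[OF that(1)] by simp
    qed
    show "ln (coth x) < a" if "0 < x" "q < x" for x
    proof -
      have "ln (tanh x) > ln (exp (- a))"
        using q[of x] that by (subst ln_less_cancel_iff) auto
      then show ?thesis using ln_coth_eq[OF that(1)] by simp
    qed
  qed (use p in auto)
qed

text \<open>Since \<open>w = ln (coth x)\<close> has \<open>w' = - 2 / sinh (2 x)\<close> and \<open>w'' = 4 cosh (2 x) / sinh\<^sup>2 (2 x)\<close>, the drift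
  \<open>2 coth (2 x) w'\<close> cancels \<open>w''\<close>: only the second order term \<open>w'\<^sup>2 \<kappa>''\<close> survives, and \<open>w'\<^sup>2 = 4 sinh\<^sup>2 w\<close>.\<close>

lemma generator_ln_coth:
  assumes \<kappa>: "C2_with \<kappa> \<kappa>' \<kappa>''" and a: "0 < a" and supp: "\<And>x. x \<notin> {a..b} \<Longrightarrow> \<kappa> x = 0"
  defines "f \<equiv> (\<lambda>x. if 0 < x then \<kappa> (ln (coth x)) else 0)"
  shows "f \<in> C2_compact_support_pos"
    and "\<And>x. 0 < x \<Longrightarrow> hyperbolic_jacobi_generator f x = 2 * (sinh (ln (coth x)))\<^sup>2 * \<kappa>'' (ln (coth x))"
proof -
  define w where "w = (\<lambda>x::real. ln (coth x))"
  define f1 where "f1 = (\<lambda>x. if 0 < x then \<kappa>' (w x) * (- 2 / sinh (2 * x)) else 0)"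
  define f2 where "f2 = (\<lambda>x. if 0 < x then \<kappa>'' (w x) * (- 2 / sinh (2 * x))\<^sup>2
     + \<kappa>' (w x) * (4 * cosh (2 * x) / (sinh (2 * x))\<^sup>2) else 0)"
  obtain p q where p: "0 < p" and pb: "\<And>x. 0 < x \<Longrightarrow> x < p \<Longrightarrow> b < w x"
    and qa: "\<And>x. 0 < x \<Longrightarrow> q < x \<Longrightarrow> w x < a"
    using ln_coth_compact_range[OF a, of b] unfolding w_def by metis
  have near0: "f x = 0" "f1 x = 0" "f2 x = 0" if "x < p" for x
  proof -
    have "w x \<notin> {a..b}" if "0 < x" using pb[OF that \<open>x < p\<close>] by auto
    moreover have "open (- {a..b})" by (rule open_Compl) simp
    ultimately have "\<kappa> (w x) = 0" "\<kappa>' (w x) = 0" "\<kappa>'' (w x) = 0" if "0 < x"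
      using that supp C2_with_const_on_open[OF \<kappa>, of "- {a..b}" 0 "w x"] by auto
    then show "f x = 0" "f1 x = 0" "f2 x = 0"
      unfolding f_def f1_def f2_def w_def by auto
  qed
  note dw = DERIV_ln_coth[folded w_def] DERIV_ln_coth'
  have d1: "(f has_real_derivative f1 x) (at x)" for x
  proof (cases "0 < x")
    case True
    have "((\<lambda>x. \<kappa> (w x)) has_real_derivative \<kappa>' (w x) * (- 2 / sinh (2 * x))) (at x)"
      by (rule DERIV_chain2[OF C2_withD(1)[OF \<kappa>] ]) (use dw(1)[OF True] in \<open>simp add: w_def\<close>)
    then have "(f has_real_derivative \<kappa>' (w x) * (- 2 / sinh (2 * x))) (at x)"
      by (rule has_field_derivative_transform_within_open[of _ _ _ "{0<..}"])
        (use True in \<open>auto simp: f_def w_def\<close>)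
    then show ?thesis using True by (simp add: f1_def)
  next
    case False
    have "((\<lambda>_. 0) has_real_derivative f1 x) (at x)"
      using False near0 p by (auto intro!: derivative_eq_intros)
    then show ?thesis
      by (rule has_field_derivative_transform_within_open[of _ _ _ "{..<p}"])
        (use False p near0 in auto)
  qed
  have d2: "(f1 has_real_derivative f2 x) (at x)" for x
  proof (cases "0 < x")
    case True
    have "((\<lambda>x. \<kappa>' (w x)) has_real_derivative \<kappa>'' (w x) * (- 2 / sinh (2 * x))) (at x)"
      by (rule DERIV_chain2[OF C2_withD(2)[OF \<kappa>] ]) (use dw(1)[OF True] in \<open>simp add: w_def\<close>)
    from DERIV_mult[OF this dw(2)[OF True]]
    have "((\<lambda>x. \<kappa>' (w x) * (- 2 / sinh (2 * x))) has_real_derivative f2 x) (at x)"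
      by (rule DERIV_cong) (use True in \<open>simp add: f2_def power2_eq_square mult_ac\<close>)
    then show ?thesis
      by (rule has_field_derivative_transform_within_open[of _ _ _ "{0<..}"])
        (use True in \<open>auto simp: f1_def\<close>)
  next
    case False
    have "((\<lambda>_. 0) has_real_derivative f2 x) (at x)"
      using False near0 p by (auto intro!: derivative_eq_intros)
    then show ?thesis
      by (rule has_field_derivative_transform_within_open[of _ _ _ "{..<p}"])
        (use False p near0 in auto)
  qed
  have w_cont: "continuous_on {0<..} w"
    by (rule continuous_at_imp_continuous_on) (auto intro: DERIV_isCont dw(1)[unfolded w_def] simp: w_def)
  have c2: "continuous_on UNIV f2"
  proof -
    have "continuous_on {0<..} (\<lambda>x. \<kappa>'' (w x) * (- 2 / sinh (2 * x))\<^sup>2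
        + \<kappa>' (w x) * (4 * cosh (2 * x) / (sinh (2 * x))\<^sup>2))"
      using w_cont
      by (auto intro!: continuous_intros continuous_on_compose2[OF C2_withD(3)[OF \<kappa>]]
          continuous_on_compose2[OF C2_withD(4)[OF \<kappa>]])
    then have 1: "continuous_on {0<..} f2"
      by (rule continuous_on_cong[THEN iffD1, rotated -1]) (auto simp: f2_def)
    have "continuous_on {..<p} (\<lambda>_::real. 0::real)" by simp
    then have 2: "continuous_on {..<p} f2"
      by (rule continuous_on_cong[THEN iffD1, rotated -1]) (auto simp: near0)
    have "continuous_on ({0<..} \<union> {..<p}) f2"
      by (rule continuous_on_open_Un[OF _ _ 1 2]) auto
    moreover have "{0<..} \<union> {..<p} = UNIV" using p by auto
    ultimately show ?thesis by simp
  qed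
  have df: "deriv f = f1" "deriv f1 = f2"
    using d1 d2 DERIV_imp_deriv by blast+
  have "\<forall>x. x \<notin> {p..q} \<longrightarrow> f x = 0"
  proof (intro allI impI)
    fix x assume x: "x \<notin> {p..q}"
    show "f x = 0"
    proof (cases "x < p")
      case False
      then have "0 < x" "q < x" using p x by auto
      then show ?thesis using qa[of x] supp[of "w x"] by (simp add: f_def w_def)
    qed (use near0 in auto)
  qed
  then show "f \<in> C2_compact_support_pos"
    unfolding C2_compact_support_pos_def using d1 d2 c2 p
    by (auto simp: df real_differentiable_def)
  show "hyperbolic_jacobi_generator f x = 2 * (sinh (ln (coth x)))\<^sup>2 * \<kappa>'' (ln (coth x))"
    if x: "0 < x" for x
  proof -
    have "sinh (2 * x) \<noteq> 0" using x by simp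
    then show ?thesis
      using x unfolding hyperbolic_jacobi_generator_def df sinh_ln_coth[OF x]
      by (simp add: f1_def f2_def w_def coth_def power2_eq_square divide_simps)
  qed
qed

section \<open>Integrals along continuous paths\<close>

lemma floor_grid_tendsto: "(\<lambda>m. real_of_int \<lfloor>real (Suc m) * x m\<rfloor> / real (Suc m)) \<longlonglongrightarrow> L" if "x \<longlonglongrightarrow> L"
proof (rule tendsto_sandwich[where f = "\<lambda>m. x m - inverse (real (Suc m))" and h = x])
  show "\<forall>\<^sub>F m in sequentially. x m - inverse (real (Suc m)) \<le> real_of_int \<lfloor>real (Suc m) * x m\<rfloor> / real (Suc m)"
  proof (intro always_eventually allI)
    fix m
    have "real (Suc m) * x m - 1 \<le> real_of_int \<lfloor>real (Suc m) * x m\<rfloor>" by linarith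
    from divide_right_mono[OF this, of "real (Suc m)"]
    show "x m - inverse (real (Suc m)) \<le> real_of_int \<lfloor>real (Suc m) * x m\<rfloor> / real (Suc m)"
      by (simp add: diff_divide_distrib inverse_eq_divide)
  qed
  show "\<forall>\<^sub>F m in sequentially. real_of_int \<lfloor>real (Suc m) * x m\<rfloor> / real (Suc m) \<le> x m"
  proof (intro always_eventually allI)
    fix m
    have "real_of_int \<lfloor>real (Suc m) * x m\<rfloor> \<le> real (Suc m) * x m" by linarith
    from divide_right_mono[OF this, of "real (Suc m)"]
    show "real_of_int \<lfloor>real (Suc m) * x m\<rfloor> / real (Suc m) \<le> x m" by simp
  qed
  show "(\<lambda>m. x m - inverse (real (Suc m))) \<longlonglongrightarrow> L"
    using tendsto_diff[OF that LIMSEQ_inverse_real_of_nat] by simp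
qed (rule that)

text \<open>A continuous path is the limit of its values on the grid of mesh \<open>1 / Suc n\<close>, and the grid is
  countable.\<close>

lemma joint_measurable_continuous_paths:
  fixes X :: "real \<Rightarrow> 'a \<Rightarrow> real"
  assumes meas: "\<And>s. a \<le> s \<Longrightarrow> s \<le> b \<Longrightarrow> X s \<in> borel_measurable N"
    and cont: "\<And>\<omega>. \<omega> \<in> space N \<Longrightarrow> continuous_on {a..b} (\<lambda>s. X s \<omega>)" and ab: "a \<le> b"
  shows "(\<lambda>(\<omega>, s). indicator {a..b} s * X s \<omega>) \<in> borel_measurable (N \<Otimes>\<^sub>M borel)"
proof -
  define c where "c = (\<lambda>(n::nat) s::real. max a (min b (real_of_int \<lfloor>real (Suc n) * s\<rfloor> / real (Suc n))))"
  have cin: "a \<le> c n s" "c n s \<le> b" for n s using ab by (auto simp: c_def)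
  have lim: "(\<lambda>n. c n s) \<longlonglongrightarrow> s" if s: "s \<in> {a..b}" for s
  proof -
    have "(\<lambda>n. real_of_int \<lfloor>real (Suc n) * s\<rfloor> / real (Suc n)) \<longlonglongrightarrow> s"
      by (rule floor_grid_tendsto) (rule tendsto_const)
    then have "(\<lambda>n. c n s) \<longlonglongrightarrow> max a (min b s)"
      unfolding c_def by (intro tendsto_intros)
    moreover have "max a (min b s) = s" using s by auto
    ultimately show ?thesis by simp
  qed
  show ?thesis
  proof (rule borel_measurable_LIMSEQ_real)
    fix n
    have "(\<lambda>p. X (max a (min b (real_of_int i / real (Suc n)))) (fst p)) \<in> borel_measurable (N \<Otimes>\<^sub>M borel)"
      for i :: int
      by (rule measurable_compose[OF measurable_fst meas]) (use ab in auto)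
    from measurable_compose_countable[OF this, of "\<lambda>p. \<lfloor>real (Suc n) * snd p\<rfloor>"]
    have "(\<lambda>p. X (c n (snd p)) (fst p)) \<in> borel_measurable (N \<Otimes>\<^sub>M borel)"
      unfolding c_def by measurable
    then show "(\<lambda>(\<omega>, s). indicator {a..b} s * X (c n s) \<omega>) \<in> borel_measurable (N \<Otimes>\<^sub>M borel)"
      unfolding case_prod_beta by measurable
  next
    fix p assume "p \<in> space (N \<Otimes>\<^sub>M (borel :: real measure))"
    then obtain \<omega> s where p: "p = (\<omega>, s)" "\<omega> \<in> space N" by (auto simp: space_pair_measure)
    show "(\<lambda>n. case p of (\<omega>, s) \<Rightarrow> indicator {a..b} s * X (c n s) \<omega>)
        \<longlonglongrightarrow> (case p of (\<omega>, s) \<Rightarrow> indicator {a..b} s * X s \<omega>)"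
    proof (cases "s \<in> {a..b}")
      case True
      have "(\<lambda>n. X (c n s) \<omega>) \<longlonglongrightarrow> X s \<omega>"
        using continuous_on_tendsto_compose[OF cont[OF p(2)] lim[OF True] True] cin by auto
      then show ?thesis using p True by simp
    qed (use p in simp)
  qed
qed

lemma set_lebesgue_integral_continuous_eq:
  fixes f :: "real \<Rightarrow> real"
  assumes "continuous_on {a..b} f"
  shows "(LBINT s:{a..b}. f s) = integral {a..b} f"
  using set_borel_integral_eq_integral(2)[OF borel_integrable_atLeastAtMost'[OF assms]] .

lemma measurable_path_integral:
  fixes X :: "real \<Rightarrow> 'a \<Rightarrow> real"
  assumes meas: "\<And>s. a \<le> s \<Longrightarrow> s \<le> b \<Longrightarrow> X s \<in> borel_measurable N"
    and cont: "\<And>\<omega>. \<omega> \<in> space N \<Longrightarrow> continuous_on {a..b} (\<lambda>s. X s \<omega>)" and ab: "a \<le> b"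
  shows "(\<lambda>\<omega>. integral {a..b} (\<lambda>s. X s \<omega>)) \<in> borel_measurable N"
proof -
  have "(\<lambda>\<omega>. \<integral>s. indicator {a..b} s * X s \<omega> \<partial>lborel) \<in> borel_measurable N"
    by (rule lborel.borel_measurable_lebesgue_integral)
      (use joint_measurable_continuous_paths[OF meas cont ab] in \<open>simp cong: measurable_cong_sets\<close>)
  moreover have "(\<integral>s. indicator {a..b} s * X s \<omega> \<partial>lborel) = integral {a..b} (\<lambda>s. X s \<omega>)"
    if "\<omega> \<in> space N" for \<omega>
    using set_lebesgue_integral_continuous_eq[OF cont[OF that]]
    by (simp add: set_lebesgue_integral_def)
  ultimately show ?thesis by (subst measurable_cong[symmetric]) auto
qed

lemma path_integral_DERIV:
  fixes f :: "real \<Rightarrow> real"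
  assumes "continuous_on {0..} f" "0 \<le> t"
  shows "((\<lambda>x. integral {0..x} f) has_real_derivative f t) (at t within {0..})"
proof -
  have "at t within {0..} = at t within {0..t + 1}"
    by (rule at_within_nhd[of _ "{..<t + 1}"]) auto
  moreover have "((\<lambda>x. integral {0..x} f) has_real_derivative f t) (at t within {0..t + 1})"
    by (rule integral_has_real_derivative) (use assms in \<open>auto intro: continuous_on_subset\<close>)
  ultimately show ?thesis by simp
qed

lemma abs_path_integral_le:
  fixes f :: "real \<Rightarrow> real"
  assumes "continuous_on {a..b} f" "a \<le> b" "\<And>x. x \<in> {a..b} \<Longrightarrow> \<bar>f x\<bar> \<le> B"
  shows "\<bar>integral {a..b} f\<bar> \<le> B * (b - a)"
  using integral_bound[OF assms(2,1)] assms(3) by simp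

lemma path_integral_diff:
  fixes f :: "real \<Rightarrow> real"
  assumes "continuous_on {0..} f" "0 \<le> a" "a \<le> b"
  shows "integral {0..b} f - integral {0..a} f = integral {a..b} f"
proof -
  have "f integrable_on {0..b}"
    by (rule integrable_continuous_real) (rule continuous_on_subset[OF assms(1)], auto)
  from Henstock_Kurzweil_Integration.integral_combine[OF assms(2,3) this] show ?thesis by simp
qed

section \<open>The martingale problem in the harmonic coordinate\<close>

lemma bounded_const_beyond:
  fixes h :: "real \<Rightarrow> real"
  assumes "continuous_on UNIV h" "\<And>x. b \<le> x \<Longrightarrow> h x = c"
  obtains B where "\<And>x. a \<le> x \<Longrightarrow> \<bar>h x\<bar> \<le> B"
proof -
  have "compact (h ` {a..b})"
    by (rule compact_continuous_image) (auto intro: continuous_on_subset[OF assms(1)])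
  then have "\<exists>B. \<forall>x\<in>{a..b}. \<bar>h x\<bar> \<le> B"
    using compact_imp_bounded[of "h ` {a..b}"] by (auto simp: bounded_iff)
  then obtain B where B: "\<And>x. x \<in> {a..b} \<Longrightarrow> \<bar>h x\<bar> \<le> B" by blast
  show ?thesis
  proof (rule that[of "max B \<bar>c\<bar>"])
    fix x assume "a \<le> x" 
    then show "\<bar>h x\<bar> \<le> max B \<bar>c\<bar>"
      using B[of x] assms(2)[of x] by (cases "b \<le> x") auto
  qed
qed

text \<open>A twice continuously differentiable function that is \<open>0\<close> up to \<open>1\<close> and \<open>1\<close> from \<open>2\<close> on.\<close>

definition smooth_step :: "real \<Rightarrow> real" where
  "smooth_step x = 1 - pos_cube (1 - pos_cube (x - 1))"

lemma smooth_step_C2: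
  obtains \<eta>' \<eta>'' B where "C2_with smooth_step \<eta>' \<eta>''"
    "\<And>x. \<bar>smooth_step x\<bar> \<le> B" "\<And>x. \<bar>\<eta>' x\<bar> \<le> B" "\<And>x. \<bar>\<eta>'' x\<bar> \<le> B"
    "\<And>x. x \<le> 1 \<Longrightarrow> smooth_step x = 0" "\<And>x. 2 \<le> x \<Longrightarrow> smooth_step x = 1"
    "\<And>x. 2 < x \<Longrightarrow> \<eta>' x = 0" "\<And>x. 2 < x \<Longrightarrow> \<eta>'' x = 0"
proof -
  note c1 = C2_with_compose[OF C2_with_pos_cube C2_with_affine[of "-1" 1]]
  note c2 = C2_with_compose[OF C2_with_affine[of 1 "-1"] c1]
  note c3 = C2_with_compose[OF C2_with_pos_cube c2]
  note c4 = C2_with_compose[OF C2_with_affine[of 1 "-1"] c3]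
  obtain \<eta>' \<eta>'' where C: "C2_with smooth_step \<eta>' \<eta>''"
    using C2_with_cong[OF c4 _ refl refl, of smooth_step] by (force simp: smooth_step_def)
  have lo: "smooth_step x = 0" if "x \<le> 1" for x
    using that by (simp add: smooth_step_def pos_cube_def max_absorb1)
  have hi: "smooth_step x = 1" if "2 \<le> x" for x
  proof -
    have "1 \<le> pos_cube (x - 1)" using that by (simp add: pos_cube_def max_absorb2)
    then show ?thesis by (simp add: smooth_step_def pos_cube_def[of "1 - _"] max_absorb1)
  qed
  have out: "\<eta>' x = 0" "\<eta>'' x = 0" if "x < 1 \<or> 2 < x" for x
    using that C2_with_const_on_open[OF C, of "{..<1}" 0 x] C2_with_const_on_open[OF C, of "{2<..}" 1 x] lo hi
    by auto
  obtain B0 where B0: "\<And>x. 0 \<le> x \<Longrightarrow> \<bar>smooth_step x\<bar> \<le> B0"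
    using bounded_const_beyond[OF C2_withD(5)[OF C] hi] by metis
  obtain B1 where B1: "\<And>x. 0 \<le> x \<Longrightarrow> \<bar>\<eta>' x\<bar> \<le> B1"
    using bounded_const_beyond[OF C2_withD(4)[OF C], of 3 0 0] out by force
  obtain B2 where B2: "\<And>x. 0 \<le> x \<Longrightarrow> \<bar>\<eta>'' x\<bar> \<le> B2"
    using bounded_const_beyond[OF C2_withD(3)[OF C], of 3 0 0] out by force
  define B where "B = max 0 (max B0 (max B1 B2))"
  show ?thesis
  proof (rule that[OF C, of B])
    fix x :: real
    show "\<bar>smooth_step x\<bar> \<le> B" using B0[of x] lo[of x] by (cases "0 \<le> x") (auto simp: B_def)
    show "\<bar>\<eta>' x\<bar> \<le> B" using B1[of x] out(1)[of x] by (cases "0 \<le> x") (auto simp: B_def)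
    show "\<bar>\<eta>'' x\<bar> \<le> B" using B2[of x] out(2)[of x] by (cases "0 \<le> x") (auto simp: B_def)
  qed (use lo hi out in auto)
qed

lemma sinh_le_mult_cosh:
  fixes x :: real
  assumes "0 \<le> x" "x \<le> b"
  shows "sinh x \<le> x * cosh b"
proof -
  have "0 * cosh b - sinh 0 \<le> x * cosh b - sinh x"
  proof (rule DERIV_nonneg_imp_nondecreasing[OF assms(1)])
    fix y assume y: "0 \<le> y" "y \<le> x"
    then have "cosh y \<le> cosh b" using assms by (subst cosh_real_nonneg_le_iff) auto
    then show "\<exists>d. ((\<lambda>y. y * cosh b - sinh y) has_real_derivative d) (at y) \<and> 0 \<le> d"
      by (intro exI[of _ "cosh b - cosh y"]) (auto intro!: derivative_eq_intros)
  qed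
  then show ?thesis by simp
qed

text \<open>The martingale problem for \<open>2 sinh\<^sup>2 w \<partial>\<^sup>2/\<partial>w\<^sup>2\<close> on the open half-line, with the martingale property
  in the form in which it is used: increments are orthogonal to every bounded variable \<open>Z\<close> of the
  past.\<close>

locale log_martingale_problem = prob_space M for M :: "'a measure" +
  fixes F :: "real \<Rightarrow> 'a measure" and W :: "real \<Rightarrow> 'a \<Rightarrow> real" and w0 :: real
  assumes subalgebra_F: "0 \<le> t \<Longrightarrow> subalgebra M (F t)"
    and adapted: "0 \<le> s \<Longrightarrow> s \<le> t \<Longrightarrow> W s \<in> borel_measurable (F t)"
    and path_continuous: "\<omega> \<in> space M \<Longrightarrow> continuous_on {0..} (\<lambda>t. W t \<omega>)"
    and path_pos: "\<omega> \<in> space M \<Longrightarrow> 0 \<le> t \<Longrightarrow> 0 < W t \<omega>"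
    and start: "\<omega> \<in> space M \<Longrightarrow> W 0 \<omega> = w0"
    and dynkin_compact: "C2_with \<kappa> \<kappa>' \<kappa>'' \<Longrightarrow> 0 < a \<Longrightarrow> (\<And>x. x \<notin> {a..b} \<Longrightarrow> \<kappa> x = 0) \<Longrightarrow>
      0 \<le> s \<Longrightarrow> s \<le> t \<Longrightarrow> Z \<in> borel_measurable (F s) \<Longrightarrow> (\<And>\<omega>. \<omega> \<in> space M \<Longrightarrow> \<bar>Z \<omega>\<bar> \<le> 1) \<Longrightarrow>
      expectation (\<lambda>\<omega>. (\<kappa> (W t \<omega>) - \<kappa> (W s \<omega>)
        - integral {s..t} (\<lambda>u. 2 * (sinh (W u \<omega>))\<^sup>2 * \<kappa>'' (W u \<omega>))) * Z \<omega>) = 0"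
begin

lemma measurable_F_imp_M: "0 \<le> t \<Longrightarrow> X \<in> borel_measurable (F t) \<Longrightarrow> X \<in> borel_measurable M"
  using subalgebra_F measurable_from_subalg by blast

lemma space_F: "0 \<le> t \<Longrightarrow> space (F t) = space M"
  using subalgebra_F by (simp add: subalgebra_def)

lemma W_measurable [measurable]: "0 \<le> t \<Longrightarrow> W t \<in> borel_measurable M"
  using adapted[of t t] measurable_F_imp_M by blast

lemma continuous_fun_path:
  assumes "continuous_on UNIV h" "\<omega> \<in> space M" "S \<subseteq> {0..}"
  shows "continuous_on S (\<lambda>t. h (W t \<omega>))"
  using continuous_on_compose2[OF assms(1) path_continuous[OF assms(2)]] assms(3)
  by (auto intro: continuous_on_subset)

lemma fun_W_measurable:
  assumes "continuous_on UNIV (h :: real \<Rightarrow> real)" "0 \<le> t"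
  shows "(\<lambda>\<omega>. h (W t \<omega>)) \<in> borel_measurable M"
  using measurable_compose[OF W_measurable[OF assms(2)] borel_measurable_continuous_onI[OF assms(1)]] .

lemma path_integral_measurable_F:
  assumes h: "continuous_on UNIV (h :: real \<Rightarrow> real)" and "0 \<le> a" "a \<le> b"
  shows "(\<lambda>\<omega>. integral {a..b} (\<lambda>s. h (W s \<omega>))) \<in> borel_measurable (F b)"
  using assms space_F[of b]
  by (intro measurable_path_integral measurable_compose[OF adapted borel_measurable_continuous_onI[OF h]]
      continuous_fun_path[OF h]) auto

lemma path_integral_measurable:
  assumes "continuous_on UNIV (h :: real \<Rightarrow> real)" "0 \<le> a" "a \<le> b"
  shows "(\<lambda>\<omega>. integral {a..b} (\<lambda>s. h (W s \<omega>))) \<in> borel_measurable M"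
  using measurable_F_imp_M[OF _ path_integral_measurable_F[OF assms]] assms by simp

text \<open>The pairs \<open>f\<close>, \<open>g\<close> of a bounded function and its bounded image under the generator for which
  \<open>f (W t)\<close> minus the integral of \<open>g (W s)\<close> is a martingale.\<close>

definition dynkin_pair :: "(real \<Rightarrow> real) \<Rightarrow> (real \<Rightarrow> real) \<Rightarrow> bool" where
  "dynkin_pair f g \<longleftrightarrow> continuous_on UNIV f \<and> continuous_on UNIV g \<and>
     (\<exists>B. \<forall>x>0. \<bar>f x\<bar> \<le> B \<and> \<bar>g x\<bar> \<le> B) \<and>
     (\<forall>s t Z. 0 \<le> s \<longrightarrow> s \<le> t \<longrightarrow> Z \<in> borel_measurable (F s) \<longrightarrow> (\<forall>\<omega>\<in>space M. \<bar>Z \<omega>\<bar> \<le> 1) \<longrightarrow>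
        expectation (\<lambda>\<omega>. (f (W t \<omega>) - f (W s \<omega>) - integral {s..t} (\<lambda>u. g (W u \<omega>))) * Z \<omega>) = 0)"

text \<open>For large \<open>w\<close> the function \<open>\<kappa> - K\<close> vanishes, so that a cut-off is made only near \<open>w = 0\<close>, with
  \<open>\<eta> (m w)\<close>. Its derivatives are nonzero only for \<open>m w \<le> 2\<close>, where the factors \<open>m\<^sup>2\<close> and \<open>m\<close> that they
  produce are compensated by \<open>sinh\<^sup>2 w \<le> (w cosh N)\<^sup>2\<close>. The approximating generators are
  therefore bounded uniformly in \<open>m\<close>, and dominated convergence applies in time and in expectation.\<close>

lemma dynkin_pair_const_at_infinity:
  assumes \<kappa>: "C2_with \<kappa> \<kappa>' \<kappa>''" and K: "\<And>x. N \<le> x \<Longrightarrow> \<kappa> x = K" and N: "0 < N"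
  shows "dynkin_pair \<kappa> (\<lambda>x. 2 * (sinh x)\<^sup>2 * \<kappa>'' x)"
proof -
  obtain \<eta>' \<eta>'' B where C: "C2_with smooth_step \<eta>' \<eta>''"
    and B: "\<And>x. \<bar>smooth_step x\<bar> \<le> B" "\<And>x. \<bar>\<eta>' x\<bar> \<le> B" "\<And>x. \<bar>\<eta>'' x\<bar> \<le> B"
    and lo: "\<And>x. x \<le> 1 \<Longrightarrow> smooth_step x = 0" and hi: "\<And>x. 2 \<le> x \<Longrightarrow> smooth_step x = 1"
    and hi': "\<And>x. 2 < x \<Longrightarrow> \<eta>' x = 0" "\<And>x. 2 < x \<Longrightarrow> \<eta>'' x = 0"
    using smooth_step_C2 by metis
  have far: "\<kappa>' x = 0" "\<kappa>'' x = 0" if "N < x" for x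
    using C2_with_const_on_open[OF \<kappa>, of "{N<..}" K x] K that by auto
  obtain B0 where B0: "\<And>x. 0 \<le> x \<Longrightarrow> \<bar>\<kappa> x\<bar> \<le> B0"
    using bounded_const_beyond[OF C2_withD(5)[OF \<kappa>] K] by metis
  obtain B1 where B1: "\<And>x. 0 \<le> x \<Longrightarrow> \<bar>\<kappa>' x\<bar> \<le> B1"
    using bounded_const_beyond[OF C2_withD(4)[OF \<kappa>], of "N + 1" 0 0] far by force
  obtain B2 where B2: "\<And>x. 0 \<le> x \<Longrightarrow> \<bar>\<kappa>'' x\<bar> \<le> B2"
    using bounded_const_beyond[OF C2_withD(3)[OF \<kappa>], of "N + 1" 0 0] far by force
  have Bpos: "0 \<le> B" "0 \<le> B0" "0 \<le> B1" "0 \<le> B2"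
    using B(1)[of 0] B0[of 0] B1[of 0] B2[of 0] by auto
  have KB: "\<bar>K\<bar> \<le> B0" using B0[of N] K[of N] N by simp
  define G where "G = (\<lambda>x. 2 * (sinh x)\<^sup>2 * \<kappa>'' x)"
  have G_cont: "continuous_on UNIV G"
    unfolding G_def using C2_withD(3)[OF \<kappa>] by (auto intro!: continuous_intros)
  define \<theta> where "\<theta> = (\<lambda>(m::nat) x. smooth_step (real (Suc m) * x) * (\<kappa> x - K))"
  define \<theta>'' where "\<theta>'' = (\<lambda>(m::nat) x. (real (Suc m))\<^sup>2 * \<eta>'' (real (Suc m) * x) * (\<kappa> x - K)
      + 2 * (real (Suc m) * \<eta>' (real (Suc m) * x)) * \<kappa>' x + smooth_step (real (Suc m) * x) * \<kappa>'' x)"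
  have \<kappa>K: "C2_with (\<lambda>x. \<kappa> x - K) \<kappa>' \<kappa>''"
    using \<kappa> unfolding C2_with_def by (auto intro!: derivative_eq_intros)
  have C2\<theta>: "\<exists>\<theta>'. C2_with (\<theta> m) \<theta>' (\<theta>'' m)" for m
  proof -
    note c = C2_with_mult[OF C2_with_compose[OF C C2_with_affine[of 0 "real (Suc m)"]] \<kappa>K]
    show ?thesis
      by (rule exI, rule C2_with_cong[OF c _ refl])
        (simp_all add: \<theta>_def \<theta>''_def algebra_simps)
  qed
  have supp: "\<theta> m x = 0" if "x \<notin> {1 / real (Suc m)..N}" for m x
  proof -
    have "real (Suc m) * x \<le> 1 \<or> N \<le> x"
      using that by (auto simp: field_simps)
    then show ?thesis using lo K by (auto simp: \<theta>_def)
  qed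
  have ev: "\<forall>\<^sub>F m in sequentially. 2 < real (Suc m) * x" if "0 < x" for x
  proof -
    have "\<forall>\<^sub>F m in sequentially. 2 / x < real m"
      using filterlim_real_sequentially by (simp add: filterlim_at_top_dense)
    then show ?thesis
      by eventually_elim (use that in \<open>simp add: field_simps\<close>)
  qed
  have lim\<theta>: "(\<lambda>m. \<theta> m x) \<longlonglongrightarrow> \<kappa> x - K" if "0 < x" for x
    by (rule tendsto_eventually) (use ev[OF that] in \<open>eventually_elim, simp add: \<theta>_def hi del: of_nat_Suc\<close>)
  have lim\<theta>'': "(\<lambda>m. 2 * (sinh x)\<^sup>2 * \<theta>'' m x) \<longlonglongrightarrow> G x" if "0 < x" for x
    by (rule tendsto_eventually)
      (use ev[OF that] in \<open>eventually_elim, simp add: \<theta>''_def G_def hi hi' del: of_nat_Suc\<close>)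
  define C0 where "C0 = 2 * (cosh N)\<^sup>2 * (4 * B * (2 * B0) + 4 * N * B * B1 + N\<^sup>2 * B * B2)"
  have C0: "0 \<le> C0" using Bpos N by (simp add: C0_def)
  have bd: "\<bar>2 * (sinh x)\<^sup>2 * \<theta>'' m x\<bar> \<le> C0" if x: "0 < x" for m x
  proof (cases "N < x")
    case True
    then show ?thesis using C0 far[OF True] K[of x] by (simp add: \<theta>''_def)
  next
    case False
    define k where "k = real (Suc m)"
    have k: "0 < k" by (simp add: k_def)
    have "sinh x \<le> x * cosh N" using sinh_le_mult_cosh[of x N] x False by simp
    then have sh: "(sinh x)\<^sup>2 \<le> (cosh N)\<^sup>2 * x\<^sup>2"
      using power_mono[of "sinh x" "x * cosh N" 2] x by (simp add: power_mult_distrib mult.commute)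
    have a1: "x\<^sup>2 * \<bar>k\<^sup>2 * \<eta>'' (k * x) * (\<kappa> x - K)\<bar> \<le> 4 * B * (2 * B0)"
    proof (cases "2 < k * x")
      case True then show ?thesis using Bpos hi' by simp
    next
      case False
      then have "(k * x)\<^sup>2 \<le> 2\<^sup>2" using k x by (intro power_mono) auto
      moreover have "\<bar>\<kappa> x - K\<bar> \<le> 2 * B0" using B0[of x] KB x by linarith
      ultimately have "(k * x)\<^sup>2 * \<bar>\<eta>'' (k * x)\<bar> * \<bar>\<kappa> x - K\<bar> \<le> 4 * B * (2 * B0)"
        using B(3)[of "k * x"] Bpos by (intro mult_mono) auto
      then show ?thesis by (simp add: abs_mult power_mult_distrib mult_ac)
    qed
    have a2: "x\<^sup>2 * \<bar>2 * (k * \<eta>' (k * x)) * \<kappa>' x\<bar> \<le> 4 * N * B * B1"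
    proof (cases "2 < k * x")
      case True then show ?thesis using Bpos hi' N by simp
    next
      case False
      then have "2 * (k * x) * x \<le> 4 * N"
        using k x \<open>\<not> N < x\<close> mult_mono[of "k * x" 2 x N] by simp
      then have "(2 * (k * x) * x) * \<bar>\<eta>' (k * x)\<bar> * \<bar>\<kappa>' x\<bar> \<le> 4 * N * B * B1"
        by (rule mult_mono[OF mult_mono[OF _ B(2)] B1]) (use Bpos k x N in auto)
      then show ?thesis using k by (simp add: abs_mult power2_eq_square mult_ac)
    qed
    have a3: "x\<^sup>2 * \<bar>smooth_step (k * x) * \<kappa>'' x\<bar> \<le> N\<^sup>2 * B * B2"
    proof -
      have "x\<^sup>2 \<le> N\<^sup>2" using x False by (intro power_mono) auto
      then have "x\<^sup>2 * \<bar>smooth_step (k * x)\<bar> * \<bar>\<kappa>'' x\<bar> \<le> N\<^sup>2 * B * B2"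
        using B(1)[of "k * x"] B2[of x] Bpos x by (intro mult_mono) auto
      then show ?thesis by (simp add: abs_mult mult_ac)
    qed
    have "x\<^sup>2 * \<bar>\<theta>'' m x\<bar> \<le> x\<^sup>2 * (\<bar>k\<^sup>2 * \<eta>'' (k * x) * (\<kappa> x - K)\<bar> + \<bar>2 * (k * \<eta>' (k * x)) * \<kappa>' x\<bar>
        + \<bar>smooth_step (k * x) * \<kappa>'' x\<bar>)"
      unfolding \<theta>''_def k_def[symmetric] by (intro mult_left_mono) auto
    also have "\<dots> \<le> 4 * B * (2 * B0) + 4 * N * B * B1 + N\<^sup>2 * B * B2"
      using a1 a2 a3 by (simp add: distrib_left)
    finally have "2 * (cosh N)\<^sup>2 * (x\<^sup>2 * \<bar>\<theta>'' m x\<bar>) \<le> C0"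
      unfolding C0_def by (intro mult_left_mono) auto
    moreover have "2 * (sinh x)\<^sup>2 * \<bar>\<theta>'' m x\<bar> \<le> 2 * ((cosh N)\<^sup>2 * x\<^sup>2) * \<bar>\<theta>'' m x\<bar>"
      using sh by (intro mult_right_mono) auto
    ultimately show ?thesis by (simp add: abs_mult mult_ac)
  qed
  have bd\<theta>: "\<bar>\<theta> m x\<bar> \<le> B * (2 * B0)" if "0 < x" for m x
  proof -
    have "\<bar>\<kappa> x - K\<bar> \<le> 2 * B0" using B0[of x] KB that by linarith
    then show ?thesis
      using B(1)[of "real (Suc m) * x"] Bpos unfolding \<theta>_def abs_mult by (intro mult_mono) auto
  qed
  have \<theta>_cont: "continuous_on UNIV (\<theta> m)" "continuous_on UNIV (\<lambda>x. 2 * (sinh x)\<^sup>2 * \<theta>'' m x)" for m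
    using C2\<theta>[of m] by (auto intro!: continuous_intros dest: C2_withD)
  have G_bd: "\<bar>G x\<bar> \<le> C0" if "0 < x" for x
    using LIMSEQ_le_const2[OF tendsto_rabs[OF lim\<theta>''[OF that]]] bd[OF that] by blast
  have "expectation (\<lambda>\<omega>. (\<kappa> (W t \<omega>) - \<kappa> (W s \<omega>) - integral {s..t} (\<lambda>u. G (W u \<omega>))) * Z \<omega>) = 0"
    if st: "0 \<le> s" "s \<le> t" and Z: "Z \<in> borel_measurable (F s)" "\<forall>\<omega>\<in>space M. \<bar>Z \<omega>\<bar> \<le> 1" for s t Z
  proof -
    have ZM [measurable]: "Z \<in> borel_measurable M" using measurable_F_imp_M[OF st(1) Z(1)] .
    define I where "I = (\<lambda>m \<omega>. (\<theta> m (W t \<omega>) - \<theta> m (W s \<omega>)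
        - integral {s..t} (\<lambda>u. 2 * (sinh (W u \<omega>))\<^sup>2 * \<theta>'' m (W u \<omega>))) * Z \<omega>)"
    define J where "J = (\<lambda>\<omega>. (\<kappa> (W t \<omega>) - \<kappa> (W s \<omega>) - integral {s..t} (\<lambda>u. G (W u \<omega>))) * Z \<omega>)"
    have I0: "expectation (I m) = 0" for m
    proof -
      obtain \<theta>' where "C2_with (\<theta> m) \<theta>' (\<theta>'' m)" using C2\<theta> by blast
      from dynkin_compact[OF this, of "1 / real (Suc m)" N s t Z] supp st Z
      show ?thesis by (simp add: I_def del: of_nat_Suc)
    qed
    have "(\<lambda>m. expectation (I m)) \<longlonglongrightarrow> expectation J"
    proof (rule integral_dominated_convergence[where w = "\<lambda>_. 4 * B * B0 + C0 * (t - s)"])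
      show "I m \<in> borel_measurable M" for m
        unfolding I_def using st
        by (auto intro!: borel_measurable_times borel_measurable_diff fun_W_measurable[OF \<theta>_cont(1)]
            path_integral_measurable[OF \<theta>_cont(2)])
      show "J \<in> borel_measurable M"
        unfolding J_def using st
        by (auto intro!: borel_measurable_times borel_measurable_diff fun_W_measurable[OF C2_withD(5)[OF \<kappa>]]
            path_integral_measurable[OF G_cont])
      show "AE \<omega> in M. (\<lambda>m. I m \<omega>) \<longlonglongrightarrow> J \<omega>"
      proof (rule AE_I2)
        fix \<omega> assume \<omega>: "\<omega> \<in> space M"
        have "(\<lambda>m. integral {s..t} (\<lambda>u. 2 * (sinh (W u \<omega>))\<^sup>2 * \<theta>'' m (W u \<omega>)))
            \<longlonglongrightarrow> integral {s..t} (\<lambda>u. G (W u \<omega>))"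
        proof (rule dominated_convergence(2)[where h = "\<lambda>_. C0"])
          show "(\<lambda>u. 2 * (sinh (W u \<omega>))\<^sup>2 * \<theta>'' m (W u \<omega>)) integrable_on {s..t}" for m
            by (rule integrable_continuous_real) (rule continuous_fun_path[OF \<theta>_cont(2) \<omega>], use st in auto)
        qed (use bd lim\<theta>'' path_pos[OF \<omega>] st in auto)
        then have "(\<lambda>m. I m \<omega>) \<longlonglongrightarrow> ((\<kappa> (W t \<omega>) - K) - (\<kappa> (W s \<omega>) - K)
            - integral {s..t} (\<lambda>u. G (W u \<omega>))) * Z \<omega>"
          unfolding I_def using st path_pos[OF \<omega>] by (intro tendsto_intros lim\<theta>) auto
        then show "(\<lambda>m. I m \<omega>) \<longlonglongrightarrow> J \<omega>" by (simp add: J_def)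
      qed
      show "AE \<omega> in M. norm (I m \<omega>) \<le> 4 * B * B0 + C0 * (t - s)" for m
      proof (rule AE_I2)
        fix \<omega> assume \<omega>: "\<omega> \<in> space M"
        have "\<bar>integral {s..t} (\<lambda>u. 2 * (sinh (W u \<omega>))\<^sup>2 * \<theta>'' m (W u \<omega>))\<bar> \<le> C0 * (t - s)"
          by (rule abs_path_integral_le)
            (use bd path_pos[OF \<omega>] st continuous_fun_path[OF \<theta>_cont(2) \<omega>] in auto)
        moreover have "\<bar>\<theta> m (W t \<omega>)\<bar> \<le> B * (2 * B0)" "\<bar>\<theta> m (W s \<omega>)\<bar> \<le> B * (2 * B0)"
          using bd\<theta> path_pos[OF \<omega>] st by auto
        ultimately have "\<bar>\<theta> m (W t \<omega>) - \<theta> m (W s \<omega>)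
          - integral {s..t} (\<lambda>u. 2 * (sinh (W u \<omega>))\<^sup>2 * \<theta>'' m (W u \<omega>))\<bar> \<le> 4 * B * B0 + C0 * (t - s)"
          by linarith
        from mult_mono[OF this, of "\<bar>Z \<omega>\<bar>" 1]
        show "norm (I m \<omega>) \<le> 4 * B * B0 + C0 * (t - s)"
          using Z(2) \<omega> Bpos C0 st by (auto simp: I_def abs_mult)
      qed
    qed simp
    then have "expectation J = 0" using I0 by (simp add: LIMSEQ_const_iff)
    then show ?thesis by (simp add: J_def)
  qed
  moreover have "\<exists>B. \<forall>x>0. \<bar>\<kappa> x\<bar> \<le> B \<and> \<bar>G x\<bar> \<le> B"
    by (rule exI[of _ "max B0 C0"]) (use B0 G_bd in \<open>force simp: le_max_iff_disj\<close>)
  ultimately show ?thesis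
    unfolding dynkin_pair_def using C2_withD(5)[OF \<kappa>] G_cont by (auto simp: G_def)
qed

lemma dynkin_pair_one: "dynkin_pair (\<lambda>_. 1) (\<lambda>_. 0)"
  unfolding dynkin_pair_def by (auto intro!: exI[of _ 1])


subsection \<open>The Feynman-Kac derivative\<close>

text \<open>The discount factor of the rate \<open>q\<close>, later a multiple of the speed of the clock or of a truncation
  of that speed.\<close>

definition discount :: "(real \<Rightarrow> real) \<Rightarrow> real \<Rightarrow> 'a \<Rightarrow> real" where
  "discount q t \<omega> = exp (- integral {0..t} (\<lambda>s. q (W s \<omega>)))"

lemma discount_measurable_F:
  "continuous_on UNIV q \<Longrightarrow> 0 \<le> t \<Longrightarrow> discount q t \<in> borel_measurable (F t)"
  unfolding discount_def[abs_def]
  by (intro measurable_compose[OF _ borel_measurable_exp] borel_measurable_uminus path_integral_measurable_F) auto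

lemma discount_measurable:
  "continuous_on UNIV q \<Longrightarrow> 0 \<le> t \<Longrightarrow> discount q t \<in> borel_measurable M"
  using discount_measurable_F measurable_F_imp_M by blast

lemma discount_mono:
  assumes q: "continuous_on UNIV q" "continuous_on UNIV q'" "\<And>x. 0 < x \<Longrightarrow> q x \<le> q' x"
    and "\<omega> \<in> space M" "0 \<le> t"
  shows "discount q' t \<omega> \<le> discount q t \<omega>"
  unfolding discount_def exp_le_cancel_iff neg_le_iff_le
  by (rule integral_le; (intro integrable_continuous_real continuous_fun_path)?)
    (use assms path_pos in auto)

lemma discount_le_1:
  assumes "continuous_on UNIV q" "\<And>x. 0 < x \<Longrightarrow> 0 \<le> q x" "\<omega> \<in> space M" "0 \<le> t"
  shows "discount q t \<omega> \<le> 1"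
  using discount_mono[of "\<lambda>_. 0" q \<omega> t] assms by (simp add: discount_def)

lemma discount_pos: "0 < discount q t \<omega>"
  by (simp add: discount_def)

lemma abs_discount_le_1:
  assumes "continuous_on UNIV q" "\<And>x. 0 < x \<Longrightarrow> 0 \<le> q x" "\<omega> \<in> space M" "0 \<le> t"
  shows "\<bar>discount q t \<omega>\<bar> \<le> 1"
  using discount_le_1[OF assms] discount_pos[of q t \<omega>] by simp

lemma discount_DERIV:
  assumes q: "continuous_on UNIV q" "\<omega> \<in> space M" "0 \<le> t"
  shows "((\<lambda>t. discount q t \<omega>) has_real_derivative - q (W t \<omega>) * discount q t \<omega>) (at t within {0..})"
  unfolding discount_def
  by (rule derivative_eq_intros path_integral_DERIV[OF continuous_fun_path[OF q(1,2)] q(3)] refl)+ auto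

lemma discount_diff_le:
  assumes q: "continuous_on UNIV q" "\<And>x. 0 < x \<Longrightarrow> 0 \<le> q x" "\<And>x. 0 < x \<Longrightarrow> q x \<le> Q"
    and \<omega>: "\<omega> \<in> space M" and "0 \<le> a" "a \<le> b"
  shows "\<bar>discount q b \<omega> - discount q a \<omega>\<bar> \<le> Q * (b - a)"
proof -
  define I where "I = integral {a..b} (\<lambda>s. q (W s \<omega>))"
  have split: "discount q b \<omega> = discount q a \<omega> * exp (- I)"
    using path_integral_diff[OF continuous_fun_path[OF q(1) \<omega> subset_refl] assms(5,6)]
    unfolding discount_def I_def exp_add[symmetric] by (simp add: algebra_simps)
  have c: "continuous_on {a..b} (\<lambda>s. q (W s \<omega>))"
    using assms(5) by (intro continuous_fun_path[OF q(1) \<omega>]) auto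
  have "\<bar>I\<bar> \<le> Q * (b - a)"
    unfolding I_def
    by (rule abs_path_integral_le[OF c assms(6)]) (use q path_pos[OF \<omega>] assms(5) in \<open>auto simp: abs_le_iff intro: order_trans[of _ 0]\<close>)
  moreover have "0 \<le> I"
    unfolding I_def by (rule integral_nonneg[OF integrable_continuous_real[OF c]])
      (use q path_pos[OF \<omega>] assms(5) in auto)
  moreover have "1 - exp (- I) \<le> I" using exp_ge_add_one_self[of "- I"] by simp
  ultimately have e: "0 \<le> 1 - exp (- I)" "1 - exp (- I) \<le> Q * (b - a)" by auto
  have "\<bar>discount q b \<omega> - discount q a \<omega>\<bar> = discount q a \<omega> * (1 - exp (- I))"
    using e discount_pos[of q a \<omega>] unfolding split by (simp add: abs_if algebra_simps)
  also have "\<dots> \<le> 1 * (1 - exp (- I))"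
    using e discount_le_1[OF q(1,2) \<omega> assms(5)] by (intro mult_right_mono) auto
  finally show ?thesis using e by simp
qed

lemma integrable_fun_discount:
  assumes f: "continuous_on UNIV f" "\<And>x. 0 < x \<Longrightarrow> \<bar>f x\<bar> \<le> B"
    and q: "continuous_on UNIV q" "\<And>x. 0 < x \<Longrightarrow> 0 \<le> q x" and that: "0 \<le> s" "0 \<le> s'"
  shows "integrable M (\<lambda>\<omega>. f (W s \<omega>) * discount q s' \<omega>)"
proof (rule integrable_const_bound[of _ B])
  have "0 \<le> B" using f(2)[of 1] by simp
  show "AE \<omega> in M. norm (f (W s \<omega>) * discount q s' \<omega>) \<le> B"
  proof (rule AE_I2)
    fix \<omega> assume \<omega>: "\<omega> \<in> space M"
    show "norm (f (W s \<omega>) * discount q s' \<omega>) \<le> B"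
      using mult_mono[OF f(2)[OF path_pos[OF \<omega> that(1)]] abs_discount_le_1[OF q(1,2) \<omega> that(2)]] \<open>0 \<le> B\<close>
      by (simp add: abs_mult)
  qed
qed (use that in \<open>intro borel_measurable_times fun_W_measurable discount_measurable f q\<close>)

text \<open>Over a short interval from \<open>a\<close> to \<open>b\<close> the increment of \<open>f (W) D\<close> is
  \<open>(f (W b) - f (W a)) D a + f (W b) (D b - D a)\<close>. As \<open>D a\<close> belongs to the past of \<open>a\<close>, the first term
  has the expectation of the integral of \<open>g (W)\<close> times \<open>D a\<close>. The difference quotients of both terms
  are bounded, since \<open>g\<close>, \<open>f\<close> and \<open>q\<close> are, and converge along every path.\<close>

lemma feynman_kac:
  assumes fg: "dynkin_pair f g" and q: "continuous_on UNIV q" "\<And>x. 0 < x \<Longrightarrow> 0 \<le> q x" "\<And>x. 0 < x \<Longrightarrow> q x \<le> Q"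
    and t: "0 \<le> t"
  shows "((\<lambda>t. expectation (\<lambda>\<omega>. f (W t \<omega>) * discount q t \<omega>)) has_real_derivative
      expectation (\<lambda>\<omega>. (g (W t \<omega>) - q (W t \<omega>) * f (W t \<omega>)) * discount q t \<omega>)) (at t within {0..})"
proof -
  have f: "continuous_on UNIV f" and g: "continuous_on UNIV g" using fg by (auto simp: dynkin_pair_def)
  obtain B where B: "\<And>x. 0 < x \<Longrightarrow> \<bar>f x\<bar> \<le> B" "\<And>x. 0 < x \<Longrightarrow> \<bar>g x\<bar> \<le> B"
    using fg unfolding dynkin_pair_def by blast
  have B0: "0 \<le> B" using B(1)[of 1] by simp
  have Q0: "0 \<le> Q" using q(2,3)[of 1] by simp
  define \<Phi> where "\<Phi> = (\<lambda>t \<omega>. integral {0..t} (\<lambda>s. g (W s \<omega>)))"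
  define u where "u = (\<lambda>t. expectation (\<lambda>\<omega>. f (W t \<omega>) * discount q t \<omega>))"
  note integr = integrable_fun_discount[OF f B(1) q(1,2)]
  have integr\<Phi>: "integrable M (\<lambda>\<omega>. (\<Phi> b \<omega> - \<Phi> a \<omega>) * discount q a \<omega>)" if "0 \<le> a" "a \<le> b" for a b
  proof (rule integrable_const_bound[of _ "B * (b - a)"])
    show "AE \<omega> in M. norm ((\<Phi> b \<omega> - \<Phi> a \<omega>) * discount q a \<omega>) \<le> B * (b - a)"
    proof (rule AE_I2)
      fix \<omega> assume \<omega>: "\<omega> \<in> space M"
      have "\<bar>\<Phi> b \<omega> - \<Phi> a \<omega>\<bar> \<le> B * (b - a)"
        unfolding \<Phi>_def path_integral_diff[OF continuous_fun_path[OF g \<omega> subset_refl] that]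
        by (rule abs_path_integral_le) (use continuous_fun_path[OF g \<omega>] that B(2) path_pos[OF \<omega>] in auto)
      from mult_mono[OF this abs_discount_le_1[OF q(1,2) \<omega> that(1)]]
      show "norm ((\<Phi> b \<omega> - \<Phi> a \<omega>) * discount q a \<omega>) \<le> B * (b - a)"
        using B0 that by (simp add: abs_mult)
    qed
    show "(\<lambda>\<omega>. (\<Phi> b \<omega> - \<Phi> a \<omega>) * discount q a \<omega>) \<in> borel_measurable M"
      unfolding \<Phi>_def using that
      by (intro borel_measurable_times borel_measurable_diff path_integral_measurable discount_measurable f g q) auto
  qed
  have incr: "u b - u a = expectation (\<lambda>\<omega>. (\<Phi> b \<omega> - \<Phi> a \<omega>) * discount q a \<omega>
      + f (W b \<omega>) * (discount q b \<omega> - discount q a \<omega>))" if ab: "0 \<le> a" "a \<le> b" for a b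
  proof -
    have "expectation (\<lambda>\<omega>. (f (W b \<omega>) - f (W a \<omega>) - integral {a..b} (\<lambda>u. g (W u \<omega>))) * discount q a \<omega>) = 0"
      using fg ab discount_measurable_F[OF q(1) ab(1)] abs_discount_le_1[OF q(1,2) _ ab(1)]
      unfolding dynkin_pair_def by blast
    also have "expectation (\<lambda>\<omega>. (f (W b \<omega>) - f (W a \<omega>) - integral {a..b} (\<lambda>u. g (W u \<omega>))) * discount q a \<omega>)
      = expectation (\<lambda>\<omega>. f (W b \<omega>) * discount q a \<omega> - f (W a \<omega>) * discount q a \<omega>
          - (\<Phi> b \<omega> - \<Phi> a \<omega>) * discount q a \<omega>)"
    proof (rule Bochner_Integration.integral_cong[OF refl])
      fix \<omega> assume \<omega>: "\<omega> \<in> space M"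
      show "(f (W b \<omega>) - f (W a \<omega>) - integral {a..b} (\<lambda>u. g (W u \<omega>))) * discount q a \<omega>
        = f (W b \<omega>) * discount q a \<omega> - f (W a \<omega>) * discount q a \<omega> - (\<Phi> b \<omega> - \<Phi> a \<omega>) * discount q a \<omega>"
        unfolding \<Phi>_def path_integral_diff[OF continuous_fun_path[OF g \<omega> subset_refl] ab]
        by (simp add: algebra_simps)
    qed
    also have "\<dots> = expectation (\<lambda>\<omega>. f (W b \<omega>) * discount q a \<omega>) - u a
        - expectation (\<lambda>\<omega>. (\<Phi> b \<omega> - \<Phi> a \<omega>) * discount q a \<omega>)"
      unfolding u_def using ab integr integr\<Phi> by (simp add: Bochner_Integration.integral_diff)
    finally show ?thesis
      unfolding u_def right_diff_distrib using ab integr integr\<Phi>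
      by (simp add: Bochner_Integration.integral_diff Bochner_Integration.integral_add)
  qed
  have "((\<lambda>y. (u y - u t) / (y - t)) \<longlongrightarrow>
      expectation (\<lambda>\<omega>. (g (W t \<omega>) - q (W t \<omega>) * f (W t \<omega>)) * discount q t \<omega>)) (at t within {0..})"
    unfolding tendsto_at_iff_sequentially comp_def
  proof (intro allI impI)
    fix X :: "nat \<Rightarrow> real" assume X: "\<forall>i. X i \<in> {0..} - {t}" "X \<longlonglongrightarrow> t"
    have X0: "0 \<le> X n" "X n \<noteq> t" for n using X(1) by auto
    \<comment> \<open>The discount factor has to be taken at the left end point, whichever of \<open>X n\<close> and \<open>t\<close> that is.\<close>
    define a where "a = (\<lambda>n. min (X n) t)"
    define b where "b = (\<lambda>n. max (X n) t)"
    have ab: "0 \<le> a n" "a n \<le> b n" "a n < b n" "0 \<le> b n" for n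
      using X0[of n] t by (auto simp: a_def b_def)
    have alim: "a \<longlonglongrightarrow> t" and blim: "b \<longlonglongrightarrow> t"
      using tendsto_min[OF X(2) tendsto_const[of t]] tendsto_max[OF X(2) tendsto_const[of t]]
      by (auto simp: a_def b_def)
    have sym: "(h (X n) - h t) / (X n - t) = (h (b n) - h (a n)) / (b n - a n)" for h :: "real \<Rightarrow> real" and n
      using X0(2)[of n] by (cases "X n \<le> t") (simp_all add: a_def b_def field_simps)
    define J where "J = (\<lambda>n \<omega>. ((\<Phi> (b n) \<omega> - \<Phi> (a n) \<omega>) * discount q (a n) \<omega>
      + f (W (b n) \<omega>) * (discount q (b n) \<omega> - discount q (a n) \<omega>)) / (b n - a n))"
    have uJ: "(u (X n) - u t) / (X n - t) = expectation (J n)" for n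
      unfolding sym[of u] incr[OF ab(1,2)] J_def by simp
    have "(\<lambda>n. expectation (J n)) \<longlonglongrightarrow>
      expectation (\<lambda>\<omega>. (g (W t \<omega>) - q (W t \<omega>) * f (W t \<omega>)) * discount q t \<omega>)"
    proof (rule integral_dominated_convergence[where w = "\<lambda>_. B + B * Q"])
      show "J n \<in> borel_measurable M" for n
        unfolding J_def \<Phi>_def using ab[of n]
        by (intro borel_measurable_divide borel_measurable_add borel_measurable_times borel_measurable_diff
            path_integral_measurable discount_measurable fun_W_measurable f g q) auto
      show "(\<lambda>\<omega>. (g (W t \<omega>) - q (W t \<omega>) * f (W t \<omega>)) * discount q t \<omega>) \<in> borel_measurable M"
        using t by (intro borel_measurable_times borel_measurable_diff discount_measurable fun_W_measurable f g q)
      show "AE \<omega> in M. (\<lambda>n. J n \<omega>) \<longlonglongrightarrow> (g (W t \<omega>) - q (W t \<omega>) * f (W t \<omega>)) * discount q t \<omega>"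
      proof (rule AE_I2)
        fix \<omega> assume \<omega>: "\<omega> \<in> space M"
        have seq: "(\<lambda>n. (h (b n) - h (a n)) / (b n - a n)) \<longlonglongrightarrow> d"
          if "(h has_real_derivative d) (at t within {0..})" for h d
          using that X unfolding has_field_derivative_iff tendsto_at_iff_sequentially comp_def
          unfolding sym[symmetric] by blast
        have 1: "(\<lambda>n. (\<Phi> (b n) \<omega> - \<Phi> (a n) \<omega>) / (b n - a n)) \<longlonglongrightarrow> g (W t \<omega>)"
          unfolding \<Phi>_def by (rule seq path_integral_DERIV continuous_fun_path g \<omega> t subset_refl)+
        have 2: "(\<lambda>n. (discount q (b n) \<omega> - discount q (a n) \<omega>) / (b n - a n)) \<longlonglongrightarrow> - q (W t \<omega>) * discount q t \<omega>"
          by (rule seq discount_DERIV q \<omega> t)+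
        have "continuous_on {0..} (\<lambda>t. discount q t \<omega>)"
          using discount_DERIV[OF q(1) \<omega>] by (auto intro!: DERIV_continuous_on)
        from continuous_on_tendsto_compose[OF this alim]
        have 3: "(\<lambda>n. discount q (a n) \<omega>) \<longlonglongrightarrow> discount q t \<omega>" using ab t by auto
        have 4: "(\<lambda>n. f (W (b n) \<omega>)) \<longlonglongrightarrow> f (W t \<omega>)"
          using continuous_on_tendsto_compose[OF continuous_fun_path[OF f \<omega> subset_refl] blim] ab t by auto
        have "(\<lambda>n. (\<Phi> (b n) \<omega> - \<Phi> (a n) \<omega>) / (b n - a n) * discount q (a n) \<omega>
           + f (W (b n) \<omega>) * ((discount q (b n) \<omega> - discount q (a n) \<omega>) / (b n - a n)))
           \<longlonglongrightarrow> g (W t \<omega>) * discount q t \<omega> + f (W t \<omega>) * (- q (W t \<omega>) * discount q t \<omega>)"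
          by (intro tendsto_intros 1 2 3 4)
        then show "(\<lambda>n. J n \<omega>) \<longlonglongrightarrow> (g (W t \<omega>) - q (W t \<omega>) * f (W t \<omega>)) * discount q t \<omega>"
          by (simp add: J_def add_divide_distrib left_diff_distrib mult.assoc mult.left_commute)
      qed
      show "AE \<omega> in M. norm (J n \<omega>) \<le> B + B * Q" for n
      proof (rule AE_I2)
        fix \<omega> assume \<omega>: "\<omega> \<in> space M"
        have "\<bar>\<Phi> (b n) \<omega> - \<Phi> (a n) \<omega>\<bar> \<le> B * (b n - a n)"
          unfolding \<Phi>_def path_integral_diff[OF continuous_fun_path[OF g \<omega> subset_refl] ab(1,2)]
          by (rule abs_path_integral_le)
            (use continuous_fun_path[OF g \<omega>] ab[of n] B(2) path_pos[OF \<omega>] in auto)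
        from mult_mono[OF this abs_discount_le_1[OF q(1,2) \<omega> ab(1)]]
        have 1: "\<bar>(\<Phi> (b n) \<omega> - \<Phi> (a n) \<omega>) * discount q (a n) \<omega>\<bar> \<le> B * (b n - a n)"
          using B0 ab[of n] by (simp add: abs_mult)
        from mult_mono[OF B(1)[OF path_pos[OF \<omega> ab(4)]] discount_diff_le[OF q \<omega> ab(1,2)]]
        have 2: "\<bar>f (W (b n) \<omega>) * (discount q (b n) \<omega> - discount q (a n) \<omega>)\<bar> \<le> B * (Q * (b n - a n))"
          using B0 by (simp add: abs_mult)
        have "\<bar>(\<Phi> (b n) \<omega> - \<Phi> (a n) \<omega>) * discount q (a n) \<omega>
          + f (W (b n) \<omega>) * (discount q (b n) \<omega> - discount q (a n) \<omega>)\<bar> \<le> (B + B * Q) * (b n - a n)"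
          using 1 2 by (simp add: algebra_simps)
        then show "norm (J n \<omega>) \<le> B + B * Q"
          using ab(3)[of n] by (simp add: J_def divide_le_eq)
      qed
    qed simp
    then show "(\<lambda>n. (u (X n) - u t) / (X n - t)) \<longlonglongrightarrow>
      expectation (\<lambda>\<omega>. (g (W t \<omega>) - q (W t \<omega>) * f (W t \<omega>)) * discount q t \<omega>)"
      unfolding uJ .
  qed
  then show ?thesis unfolding has_field_derivative_iff u_def .
qed

end

section \<open>The Laplace transform of the clock\<close>

lemma DERIV_within_nonneg_imp_le:
  fixes u v :: "real \<Rightarrow> real"
  assumes der: "\<And>t. 0 \<le> t \<Longrightarrow> (u has_real_derivative v t) (at t within {0..})"
    and nonneg: "\<And>t. 0 \<le> t \<Longrightarrow> 0 \<le> v t" and T: "0 \<le> T"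
  shows "u 0 \<le> u T"
proof (cases "T = 0")
  case False
  have "\<exists>x\<in>{0..T}. u T - u 0 = v x * (T - 0)"
  proof (rule mvt_very_simple)
    fix x assume "0 \<le> x" "x \<le> T"
    then show "(u has_derivative (*) (v x)) (at x within {0..T})"
      using der[of x] unfolding has_field_derivative_def by (auto intro: has_derivative_subset)
  qed (use T False in auto)
  then obtain x where "0 \<le> x" "u T - u 0 = v x * T" by auto
  moreover have "0 \<le> v x * T" using nonneg[OF \<open>0 \<le> x\<close>] T by simp
  ultimately show ?thesis by simp
qed simp

definition clock_rate :: "real \<Rightarrow> real" where
  "clock_rate x = 4 * (sinh x)\<^sup>2"

text \<open>The truncation makes the rate bounded, as \<open>feynman_kac\<close> requires.\<close>

definition truncated_rate :: "real \<Rightarrow> real \<Rightarrow> real \<Rightarrow> real" where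
  "truncated_rate c n x = c * min n (clock_rate x)"

lemma clock_rate_continuous: "continuous_on UNIV (\<lambda>x. c * clock_rate x)"
  unfolding clock_rate_def by (intro continuous_intros)

lemma truncated_rate_continuous: "continuous_on UNIV (truncated_rate c n)"
  unfolding truncated_rate_def[abs_def] clock_rate_def by (intro continuous_intros)

lemma clock_rate_nonneg: "0 \<le> clock_rate x"
  by (simp add: clock_rate_def)

lemma truncated_rate_bounds:
  assumes "0 \<le> c" "0 \<le> n"
  shows "0 \<le> truncated_rate c n x" "truncated_rate c n x \<le> c * n"
    "truncated_rate c n x \<le> c * clock_rate x"
  using assms clock_rate_nonneg[of x] unfolding truncated_rate_def
  by (auto intro!: mult_left_mono)

lemma clock_rate_mono: "0 \<le> x \<Longrightarrow> x \<le> y \<Longrightarrow> clock_rate x \<le> clock_rate y"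
  unfolding clock_rate_def by (auto intro!: power_mono)

lemma le_sinh:
  fixes x :: real
  assumes "0 \<le> x" 
  shows "x \<le> sinh x"
proof -
  have "sinh 0 - 0 \<le> sinh x - x"
  proof (rule DERIV_nonneg_imp_nondecreasing[OF assms])
    fix y :: real
    show "\<exists>d. ((\<lambda>y. sinh y - y) has_real_derivative d) (at y) \<and> 0 \<le> d"
      by (intro exI[of _ "cosh y - 1"]) (auto intro!: derivative_eq_intros simp: cosh_real_ge_1)
  qed
  then show ?thesis by simp
qed

text \<open>If \<open>p\<close> is convex and decreasing, then \<open>k = exp (- l x) p\<close> satisfies \<open>k'' = l\<^sup>2 k + exp (- l x) (p'' - 2 l p')\<close>,
  which is at least \<open>l\<^sup>2 k\<close>. Here \<open>p\<close> is the positive part of \<open>1 - x / N\<close>, cubed.\<close>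

lemma subsolution:
  assumes "0 < l" "0 < N"
  defines "k \<equiv> \<lambda>x. exp (- l * x) * pos_cube (1 - x / N)"
  obtains k' k'' where "C2_with k k' k''" "\<And>x. N \<le> x \<Longrightarrow> k x = 0"
    "\<And>x. 0 < x \<Longrightarrow> 0 \<le> k x \<and> k x \<le> 1" "\<And>x. l\<^sup>2 * k x \<le> k'' x"
proof -
  note c = C2_with_mult[OF C2_with_exp[of "- l"]
      C2_with_compose[OF C2_with_pos_cube C2_with_affine[of 1 "- 1 / N"]]]
  define y where "y = (\<lambda>x. max 0 (1 - x / N))"
  have y0: "0 \<le> y x" for x by (simp add: y_def)
  show ?thesis
  proof (rule that)
    show "C2_with k (\<lambda>x. - l * k x + exp (- l * x) * (3 * (y x)\<^sup>2 * (- 1 / N)))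
       (\<lambda>x. l\<^sup>2 * k x + exp (- l * x) * (2 * l * (3 * (y x)\<^sup>2 / N) + 6 * y x / N\<^sup>2))"
      by (rule C2_with_cong[OF c]) (auto simp: k_def y_def field_simps power2_eq_square)
    show "k x = 0" if "N \<le> x" for x
      using that assms(2) by (simp add: k_def pos_cube_def max_absorb1)
    show "l\<^sup>2 * k x \<le> l\<^sup>2 * k x + exp (- l * x) * (2 * l * (3 * (y x)\<^sup>2 / N) + 6 * y x / N\<^sup>2)" for x
      using assms(1,2) y0[of x] by simp
    show "0 \<le> k x \<and> k x \<le> 1" if "0 < x" for x
    proof -
      have p: "0 \<le> pos_cube (1 - x / N)" "pos_cube (1 - x / N) \<le> 1"
        using that assms(2) unfolding pos_cube_def by (auto intro!: power_le_one)
      have "exp (- l * x) \<le> 1" using that assms(1) by simp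
      then have "exp (- l * x) * pos_cube (1 - x / N) \<le> 1 * 1" using p by (intro mult_mono) auto
      then show ?thesis using p by (simp add: k_def)
    qed
  qed
qed

text \<open>Write \<open>k = exp (- m G)\<close> with \<open>G = (N / 3) (1 - p)\<close>, where \<open>p\<close> is the positive part of \<open>1 - x / N\<close>, cubed. This \<open>G\<close>
  is a concave truncation of the identity: \<open>G \<le> x\<close>, \<open>0 \<le> G' \<le> 1\<close>, \<open>- 2 / N \<le> G'' \<le> 0\<close>, and \<open>G\<close> is constant from \<open>N\<close> on.
  Hence \<open>k'' = k (m\<^sup>2 G'\<^sup>2 - m G'')\<close> is at most \<open>k (m\<^sup>2 + 2 m / N)\<close>. Lowering the exponent from \<open>l\<close> to
  \<open>m = l - 1 / N\<close> pays for the concavity of \<open>G\<close>, as \<open>m\<^sup>2 + 2 m / N = l\<^sup>2 - 1 / N\<^sup>2\<close>.\<close>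

lemma supersolution:
  assumes "0 < l" "0 < N" "1 / N \<le> l"
  defines "k \<equiv> \<lambda>x. exp (- (l - 1 / N) * (N / 3 * (1 - pos_cube (1 - x / N))))"
  obtains k' k'' where "C2_with k k' k''" "\<And>x. N \<le> x \<Longrightarrow> k x = exp (- (l - 1 / N) * (N / 3))"
    "\<And>x. N \<le> x \<Longrightarrow> k'' x = 0" "\<And>x. 0 < x \<Longrightarrow> exp (- l * x) \<le> k x" "\<And>x. 0 < x \<Longrightarrow> k x \<le> 1"
    "\<And>x. 0 < x \<Longrightarrow> k'' x \<le> l\<^sup>2 * k x"
proof -
  define m where "m = l - 1 / N"
  have m0: "0 \<le> m" "m \<le> l" using assms by (auto simp: m_def)
  define G where "G = (\<lambda>x. N / 3 * (1 - pos_cube (1 - x / N)))"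
  define y where "y = (\<lambda>x. max 0 (1 - x / N))"
  have y0: "0 \<le> y x" for x by (simp add: y_def)
  note cG = C2_with_compose[OF C2_with_affine[of "N / 3" "- N / 3"]
      C2_with_compose[OF C2_with_pos_cube C2_with_affine[of 1 "- 1 / N"]]]
  have G2: "C2_with G (\<lambda>x. (y x)\<^sup>2) (\<lambda>x. - 2 * y x / N)"
    by (rule C2_with_cong[OF cG]) (use assms(2) in \<open>auto simp: G_def y_def field_simps power2_eq_square\<close>)
  note ck = C2_with_compose[OF C2_with_exp[of "- m"] G2]
  have kG: "k x = exp (- m * G x)" for x by (simp add: k_def m_def G_def)
  have G0: "0 \<le> G x \<and> G x \<le> x" if "0 < x" for x
  proof -
    define z where "z = x / N"
    have z: "0 < z" "x = N * z" using that assms(2) by (auto simp: z_def)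
    have "1 - 3 * z \<le> pos_cube (1 - z) \<and> pos_cube (1 - z) \<le> 1"
    proof (cases "z \<le> 1")
      case True
      have "0 \<le> z * z * (3 - z)" using z True by (intro mult_nonneg_nonneg) auto
      then have "1 - 3 * z \<le> (1 - z) ^ 3" by (simp add: power3_eq_cube algebra_simps)
      moreover have "(1 - z) ^ 3 \<le> 1" using True z by (intro power_le_one) auto
      ultimately show ?thesis using True by (simp add: pos_cube_def max_absorb2)
    qed (use z in \<open>simp add: pos_cube_def max_absorb1\<close>)
    then have "N / 3 * 0 \<le> N / 3 * (1 - pos_cube (1 - z))" "N / 3 * (1 - pos_cube (1 - z)) \<le> N / 3 * (3 * z)"
      using assms(2) by (auto intro!: mult_left_mono)
    then show ?thesis using z(2) by (simp add: G_def z_def[symmetric])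
  qed
  show ?thesis
  proof (rule that)
    show "C2_with k (\<lambda>x. - m * k x * (y x)\<^sup>2) (\<lambda>x. k x * (m\<^sup>2 * (y x) ^ 4 + 2 * m * y x / N))"
      by (rule C2_with_cong[OF ck]) (auto simp: kG field_simps power2_eq_square power4_eq_xxxx)
    show "k x = exp (- (l - 1 / N) * (N / 3))" if "N \<le> x" for x
      using that assms(2) by (simp add: k_def pos_cube_def max_absorb1)
    show "k x * (m\<^sup>2 * (y x) ^ 4 + 2 * m * y x / N) = 0" if "N \<le> x" for x
      using that assms(2) by (simp add: y_def max_absorb1)
    fix x :: real assume x: "0 < x"
    have "m * G x \<le> l * x" using m0 G0[OF x] x by (intro mult_mono) auto
    then show "exp (- l * x) \<le> k x" by (simp add: kG)
    show "k x \<le> 1" using m0 G0[OF x] by (simp add: kG)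
    have "y x \<le> 1" using x assms(2) by (simp add: y_def)
    then have "m\<^sup>2 * (y x) ^ 4 + 2 * m * y x / N \<le> m\<^sup>2 * 1 + 2 * m * 1 / N"
      using y0[of x] m0 assms(2)
      by (intro add_mono mult_left_mono divide_right_mono power_le_one) auto
    also have "\<dots> = l\<^sup>2 - (1 / N)\<^sup>2" using assms(2) by (simp add: m_def power2_eq_square field_simps)
    also have "\<dots> \<le> l\<^sup>2" by simp
    finally have "k x * (m\<^sup>2 * (y x) ^ 4 + 2 * m * y x / N) \<le> k x * l\<^sup>2"
      by (rule mult_left_mono) (simp add: kG)
    then show "k x * (m\<^sup>2 * (y x) ^ 4 + 2 * m * y x / N) \<le> l\<^sup>2 * k x" by (simp add: mult.commute)
  qed
qed

context log_martingale_problem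
begin

lemma expectation_start:
  "expectation (\<lambda>\<omega>. f (W 0 \<omega>) * discount q 0 \<omega>) = f w0"
proof -
  have "expectation (\<lambda>\<omega>. f (W 0 \<omega>) * discount q 0 \<omega>) = expectation (\<lambda>\<omega>. f w0)"
    by (rule Bochner_Integration.integral_cong) (auto simp: start discount_def)
  then show ?thesis by (simp add: prob_space)
qed

lemma w0_pos: "0 < w0"
proof -
  obtain \<omega> where "\<omega> \<in> space M" using not_empty by blast
  then show ?thesis using path_pos[of \<omega> 0] start by auto
qed

lemma expectation_fun_discount_mono:
  assumes f: "continuous_on UNIV f" "\<And>x. 0 < x \<Longrightarrow> \<bar>f x\<bar> \<le> B"
    and g: "continuous_on UNIV g" "\<And>x. 0 < x \<Longrightarrow> \<bar>g x\<bar> \<le> C"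
    and q: "continuous_on UNIV q" "\<And>x. 0 < x \<Longrightarrow> 0 \<le> q x"
    and le: "\<And>x. 0 < x \<Longrightarrow> f x \<le> g x" and t: "0 \<le> t"
  shows "expectation (\<lambda>\<omega>. f (W t \<omega>) * discount q t \<omega>) \<le> expectation (\<lambda>\<omega>. g (W t \<omega>) * discount q t \<omega>)"
proof (rule integral_mono)
  show "integrable M (\<lambda>\<omega>. f (W t \<omega>) * discount q t \<omega>)" "integrable M (\<lambda>\<omega>. g (W t \<omega>) * discount q t \<omega>)"
    using integrable_fun_discount[OF f q t t] integrable_fun_discount[OF g q t t] by auto
  show "f (W t \<omega>) * discount q t \<omega> \<le> g (W t \<omega>) * discount q t \<omega>" if "\<omega> \<in> space M" for \<omega>
    using le[OF path_pos[OF that t]] discount_pos[of q t \<omega>] by (intro mult_right_mono) auto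
qed

text \<open>With a subsolution that vanishes from \<open>N\<close> on, the discounted expectation increases, whatever
  the truncation level \<open>n\<close> of the rate.\<close>

lemma discounted_subsolution:
  assumes l: "0 < l" and N: "0 < N" and n: "0 \<le> n" and t: "0 \<le> t"
  shows "exp (- l * w0) * pos_cube (1 - w0 / N) \<le> expectation (\<lambda>\<omega>. 1 * discount (truncated_rate (l\<^sup>2 / 2) n) t \<omega>)"
proof -
  define k where "k = (\<lambda>x. exp (- l * x) * pos_cube (1 - x / N))"
  obtain k' k'' where C: "C2_with k k' k''" and z: "\<And>x. N \<le> x \<Longrightarrow> k x = 0"
    and k01: "\<And>x. 0 < x \<Longrightarrow> 0 \<le> k x \<and> k x \<le> 1" and sub: "\<And>x. l\<^sup>2 * k x \<le> k'' x"
    using subsolution[OF l N] unfolding k_def by blast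
  define q where "q = truncated_rate (l\<^sup>2 / 2) n"
  have q: "continuous_on UNIV q" "\<And>x. 0 \<le> q x" "\<And>x. q x \<le> l\<^sup>2 / 2 * n"
    "\<And>x. q x \<le> l\<^sup>2 / 2 * clock_rate x"
    unfolding q_def using truncated_rate_continuous truncated_rate_bounds[OF _ n, of "l\<^sup>2 / 2"] by simp_all
  have "k w0 = expectation (\<lambda>\<omega>. k (W 0 \<omega>) * discount q 0 \<omega>)" by (rule expectation_start[symmetric])
  also have "\<dots> \<le> expectation (\<lambda>\<omega>. k (W t \<omega>) * discount q t \<omega>)"
  proof (rule DERIV_within_nonneg_imp_le[OF feynman_kac[OF dynkin_pair_const_at_infinity[OF C z N] q(1,2,3)] _ t])
    fix t :: real assume t: "0 \<le> t"
    show "0 \<le> expectation (\<lambda>\<omega>. (2 * (sinh (W t \<omega>))\<^sup>2 * k'' (W t \<omega>) - q (W t \<omega>) * k (W t \<omega>)) * discount q t \<omega>)"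
    proof (intro integral_nonneg_AE AE_I2 mult_nonneg_nonneg)
      fix \<omega> assume \<omega>: "\<omega> \<in> space M"
      define x where "x = W t \<omega>"
      have x: "0 < x" using path_pos[OF \<omega> t] by (simp add: x_def)
      have "q x * k x \<le> l\<^sup>2 / 2 * clock_rate x * k x"
        using q(4) k01[OF x] by (intro mult_right_mono) auto
      also have "\<dots> = 2 * (sinh x)\<^sup>2 * (l\<^sup>2 * k x)" by (simp add: clock_rate_def)
      also have "\<dots> \<le> 2 * (sinh x)\<^sup>2 * k'' x" using sub by (intro mult_left_mono) auto
      finally show "0 \<le> 2 * (sinh (W t \<omega>))\<^sup>2 * k'' (W t \<omega>) - q (W t \<omega>) * k (W t \<omega>)" by (simp add: x_def)
    qed (simp add: discount_pos less_imp_le)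
  qed
  also have "\<dots> \<le> expectation (\<lambda>\<omega>. 1 * discount q t \<omega>)"
    by (rule expectation_fun_discount_mono[OF C2_withD(5)[OF C], where B = 1 and g = "\<lambda>_. 1" and C = 1])
      (use k01 q t in auto)
  finally show ?thesis by (simp add: k_def q_def)
qed

text \<open>With a supersolution \<open>k\<close> the discounted expectation decreases, provided that the rate is truncated
  only where \<open>k\<close> is constant; this fixes the lower bound \<open>clock_rate N\<close> for \<open>n\<close>. The function \<open>k\<close> is then
  traded for \<open>1\<close> by means of \<open>1 - k \<le> l \<delta> + C q\<close>. The average over \<open>0 \<le> t \<le> T\<close> of the last term is at
  most \<open>C / T\<close>, since \<open>E (q D)\<close> is minus the derivative of \<open>E D\<close>, and \<open>E D\<close> at time \<open>T\<close> is below its average.\<close>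

lemma discounted_supersolution:
  assumes l: "0 < l" and N: "0 < N" "1 / N \<le> l" and \<delta>: "0 < \<delta>" and T: "0 < T"
  shows "\<exists>n\<ge>0. expectation (\<lambda>\<omega>. 1 * discount (truncated_rate (l\<^sup>2 / 2) n) T \<omega>)
     \<le> exp (- (l - 1 / N) * (N / 3 * (1 - pos_cube (1 - w0 / N)))) + l * \<delta> + 1 / (2 * l\<^sup>2 * \<delta>\<^sup>2) / T"
proof -
  define k where "k = (\<lambda>x. exp (- (l - 1 / N) * (N / 3 * (1 - pos_cube (1 - x / N)))))"
  obtain k' k'' where C: "C2_with k k' k''" and K: "\<And>x. N \<le> x \<Longrightarrow> k x = exp (- (l - 1 / N) * (N / 3))"
    and K'': "\<And>x. N \<le> x \<Longrightarrow> k'' x = 0"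
    and k1: "\<And>x. 0 < x \<Longrightarrow> exp (- l * x) \<le> k x" "\<And>x. 0 < x \<Longrightarrow> k x \<le> 1" 
    and super: "\<And>x. 0 < x \<Longrightarrow> k'' x \<le> l\<^sup>2 * k x"
    using supersolution[OF l N] unfolding k_def by blast
  have k0: "0 < k x" for x by (simp add: k_def)
  define n where "n = max (4 * \<delta>\<^sup>2) (clock_rate N)"
  have n: "0 \<le> n" by (simp add: n_def le_max_iff_disj)
  define q where "q = truncated_rate (l\<^sup>2 / 2) n"
  have q: "continuous_on UNIV q" "\<And>x. 0 \<le> q x" "\<And>x. q x \<le> l\<^sup>2 / 2 * n"
    unfolding q_def using truncated_rate_continuous truncated_rate_bounds[OF _ n, of "l\<^sup>2 / 2"] by simp_all
  have kD: "expectation (\<lambda>\<omega>. k (W t \<omega>) * discount q t \<omega>) \<le> k w0" if t: "0 \<le> t" for t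
  proof -
    have "- expectation (\<lambda>\<omega>. k (W 0 \<omega>) * discount q 0 \<omega>) \<le> - expectation (\<lambda>\<omega>. k (W t \<omega>) * discount q t \<omega>)"
    proof (rule DERIV_within_nonneg_imp_le[OF DERIV_minus[OF feynman_kac[OF dynkin_pair_const_at_infinity[OF C K N(1)] q(1,2,3)]] _ t])
      fix t :: real assume t: "0 \<le> t"
      have "0 \<le> expectation (\<lambda>\<omega>. - ((2 * (sinh (W t \<omega>))\<^sup>2 * k'' (W t \<omega>) - q (W t \<omega>) * k (W t \<omega>)) * discount q t \<omega>))"
      proof (intro integral_nonneg_AE AE_I2)
        fix \<omega> assume \<omega>: "\<omega> \<in> space M"
        define x where "x = W t \<omega>"
        have x: "0 < x" using path_pos[OF \<omega> t] by (simp add: x_def)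
        have "2 * (sinh x)\<^sup>2 * k'' x - q x * k x \<le> 0"
        proof (cases "N \<le> x")
          case True
          then show ?thesis using K'' q(2)[of x] k0[of x] by simp
        next
          case False
          then have "clock_rate x \<le> n" using clock_rate_mono[of x N] x by (simp add: n_def)
          then have "q x = 2 * (sinh x)\<^sup>2 * l\<^sup>2" by (simp add: q_def truncated_rate_def clock_rate_def)
          moreover have "2 * (sinh x)\<^sup>2 * k'' x \<le> 2 * (sinh x)\<^sup>2 * (l\<^sup>2 * k x)"
            using super[OF x] by (intro mult_left_mono) auto
          ultimately show ?thesis by simp
        qed
        then show "0 \<le> - ((2 * (sinh (W t \<omega>))\<^sup>2 * k'' (W t \<omega>) - q (W t \<omega>) * k (W t \<omega>)) * discount q t \<omega>)"
          using discount_pos[of q t \<omega>] by (simp add: x_def mult_le_0_iff)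
      qed
      then show "0 \<le> - expectation (\<lambda>\<omega>. (2 * (sinh (W t \<omega>))\<^sup>2 * k'' (W t \<omega>) - q (W t \<omega>) * k (W t \<omega>)) * discount q t \<omega>)"
        by simp
    qed
    then show ?thesis unfolding expectation_start by simp
  qed
  define C where "C = 1 / (2 * l\<^sup>2 * \<delta>\<^sup>2)"
  have C0: "0 < C" using l \<delta> by (simp add: C_def)
  \<comment> \<open>Below \<open>\<delta>\<close> the bound \<open>1 - k \<le> l x\<close> suffices; above \<open>\<delta>\<close> the rate is so large that \<open>C q \<ge> 1\<close>, also after truncation because \<open>n \<ge> 4 \<delta>\<^sup>2\<close>.\<close>
  have one_minus_k: "1 \<le> k x + l * \<delta> + C * q x" if x: "0 < x" for x
  proof (cases "x \<le> \<delta>")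
    case True
    have "1 - l * x \<le> k x" using k1(1)[OF x] exp_ge_add_one_self[of "- l * x"] by simp
    moreover have "l * x \<le> l * \<delta>" using True l by simp
    moreover have "0 \<le> C * q x" using C0 q(2)[of x] by simp
    ultimately show ?thesis by linarith
  next
    case False
    then have "\<delta>\<^sup>2 \<le> (sinh x)\<^sup>2" using le_sinh[of x] x \<delta> by (intro power_mono) auto
    then have "4 * \<delta>\<^sup>2 \<le> min n (clock_rate x)" by (simp add: n_def clock_rate_def)
    then have "l\<^sup>2 / 2 * (4 * \<delta>\<^sup>2) \<le> q x" unfolding q_def truncated_rate_def by (intro mult_left_mono) auto
    then have "C * (l\<^sup>2 / 2 * (4 * \<delta>\<^sup>2)) \<le> C * q x" using C0 by (intro mult_left_mono) auto
    moreover have "C * (l\<^sup>2 / 2 * (4 * \<delta>\<^sup>2)) = 1" using l \<delta> by (simp add: C_def field_simps)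
    moreover have "0 \<le> l * \<delta>" using l \<delta> by simp
    ultimately show ?thesis using k0[of x] by linarith
  qed
  define y where "y = (\<lambda>t. expectation (\<lambda>\<omega>. 1 * discount q t \<omega>))"
  define y' where "y' = (\<lambda>t. expectation (\<lambda>\<omega>. q (W t \<omega>) * discount q t \<omega>))"
  have dy: "(y has_real_derivative - y' t) (at t within {0..})" if "0 \<le> t" for t
    using feynman_kac[OF dynkin_pair_one q(1,2,3) that] unfolding y_def y'_def by simp
  have y'0: "0 \<le> y' t" if "0 \<le> t" for t
    unfolding y'_def using q(2) less_imp_le[OF discount_pos]
    by (intro integral_nonneg_AE AE_I2 mult_nonneg_nonneg) auto
  have y_le: "y t \<le> k w0 + l * \<delta> + C * y' t" if t: "0 \<le> t" for t
  proof -
    have i1: "integrable M (\<lambda>\<omega>. k (W t \<omega>) * discount q t \<omega>)"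
      by (rule integrable_fun_discount[of _ 1]) (use k0 k1 C2_withD(5)[OF C] q t in \<open>auto simp: abs_of_pos\<close>)
    have i2: "integrable M (\<lambda>\<omega>. discount q t \<omega>)"
      using integrable_fun_discount[of "\<lambda>_. 1" 1 q t t] q t by simp
    have i3: "integrable M (\<lambda>\<omega>. q (W t \<omega>) * discount q t \<omega>)"
      by (rule integrable_fun_discount[of _ "l\<^sup>2 / 2 * n"]) (use q t in \<open>auto simp: abs_of_nonneg\<close>)
    have i2': "integrable M (\<lambda>\<omega>. l * \<delta> * discount q t \<omega>)" and i3': "integrable M (\<lambda>\<omega>. C * (q (W t \<omega>) * discount q t \<omega>))"
      using i2 i3 by auto
    have "y t \<le> expectation (\<lambda>\<omega>. k (W t \<omega>) * discount q t \<omega> + l * \<delta> * discount q t \<omega> + C * (q (W t \<omega>) * discount q t \<omega>))"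
      unfolding y_def
    proof (rule integral_mono)
      fix \<omega> assume \<omega>: "\<omega> \<in> space M"
      from mult_right_mono[OF one_minus_k[OF path_pos[OF \<omega> t]] less_imp_le[OF discount_pos[of q t \<omega>]]]
      show "1 * discount q t \<omega> \<le> k (W t \<omega>) * discount q t \<omega> + l * \<delta> * discount q t \<omega> + C * (q (W t \<omega>) * discount q t \<omega>)"
        by (simp add: algebra_simps)
    qed (use i1 i2 i2' i3' in auto)
    also have "\<dots> = expectation (\<lambda>\<omega>. k (W t \<omega>) * discount q t \<omega>) + l * \<delta> * expectation (\<lambda>\<omega>. discount q t \<omega>) + C * y' t"
      using i1 i2' i3' by (simp add: y'_def Bochner_Integration.integral_add)
    also have "\<dots> \<le> k w0 + l * \<delta> * 1 + C * y' t"
    proof (intro add_mono mult_left_mono kD t order_refl)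
      have "expectation (\<lambda>\<omega>. discount q t \<omega>) \<le> expectation (\<lambda>\<omega>. 1)"
        using i2 discount_le_1[OF q(1,2) _ t] by (intro integral_mono) auto
      then show "expectation (\<lambda>\<omega>. discount q t \<omega>) \<le> 1" by (simp add: prob_space)
    qed (use l \<delta> C0 in auto)
    finally show ?thesis by simp
  qed
  \<comment> \<open>The function \<open>t y - t (k w0 + l \<delta>) + C y\<close> decreases: its derivative is the defect in \<open>y_le\<close> plus \<open>- t y'\<close> with \<open>0 \<le> y'\<close>.\<close>
  have "- (0 * y 0 - 0 * (k w0 + l * \<delta>) + C * y 0) \<le> - (T * y T - T * (k w0 + l * \<delta>) + C * y T)"
  proof (rule DERIV_within_nonneg_imp_le)
    fix t :: real assume t: "0 \<le> t"
    show "((\<lambda>t. - (t * y t - t * (k w0 + l * \<delta>) + C * y t)) has_real_derivative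
        - (y t - t * y' t - (k w0 + l * \<delta>) - C * y' t)) (at t within {0..})"
      by (rule derivative_eq_intros dy[OF t] refl)+ (simp add: algebra_simps)
    have "0 \<le> t * y' t" using t y'0[OF t] by simp
    then show "0 \<le> - (y t - t * y' t - (k w0 + l * \<delta>) - C * y' t)" using y_le[OF t] by linarith
  qed (use T in auto)
  moreover have "y 0 = 1" unfolding y_def by (rule expectation_start[of "\<lambda>_. 1" q])
  moreover have "0 \<le> C * y T"
  proof -
    have "0 \<le> y T" unfolding y_def using less_imp_le[OF discount_pos] by (intro integral_nonneg_AE AE_I2) auto
    then show ?thesis using C0 by simp
  qed
  ultimately have "T * y T \<le> T * (k w0 + l * \<delta>) + C" by simp
  then have "y T \<le> k w0 + l * \<delta> + C / T" using T by (simp add: field_simps)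
  then show ?thesis using n by (intro exI[of _ n]) (simp add: y_def q_def k_def C_def)
qed

text \<open>First \<open>N\<close> tends to infinity in \<open>discounted_subsolution\<close>, then the truncation level of the rate: a
  single path is bounded on \<open>{0..t}\<close>, so that on it the truncation is eventually void.\<close>

lemma laplace_lower:
  assumes l: "0 < l" and t: "0 \<le> t"
  shows "exp (- l * w0) \<le> expectation (\<lambda>\<omega>. discount (\<lambda>x. l\<^sup>2 / 2 * clock_rate x) t \<omega>)"
proof -
  have n: "exp (- l * w0) \<le> expectation (\<lambda>\<omega>. discount (truncated_rate (l\<^sup>2 / 2) (real n)) t \<omega>)" for n
  proof (rule LIMSEQ_le_const2)
    have "(\<lambda>m. 1 - w0 * inverse (real (Suc m))) \<longlonglongrightarrow> 1 - w0 * 0"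
      by (intro tendsto_diff tendsto_mult tendsto_const LIMSEQ_inverse_real_of_nat)
    from tendsto_mult[OF tendsto_const[of "exp (- l * w0)"] tendsto_power[OF tendsto_max[OF tendsto_const[of 0] this], of 3]]
    show "(\<lambda>m. exp (- l * w0) * pos_cube (1 - w0 / real (Suc m))) \<longlonglongrightarrow> exp (- l * w0)"
      by (simp add: pos_cube_def divide_inverse)
    show "\<exists>N. \<forall>m\<ge>N. exp (- l * w0) * pos_cube (1 - w0 / real (Suc m))
        \<le> expectation (\<lambda>\<omega>. discount (truncated_rate (l\<^sup>2 / 2) (real n)) t \<omega>)"
      using discounted_subsolution[OF l _ _ t, of "real (Suc _)" "real n"] by simp
  qed
  have "(\<lambda>n. expectation (\<lambda>\<omega>. discount (truncated_rate (l\<^sup>2 / 2) (real n)) t \<omega>))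
      \<longlonglongrightarrow> expectation (\<lambda>\<omega>. discount (\<lambda>x. l\<^sup>2 / 2 * clock_rate x) t \<omega>)"
  proof (rule integral_dominated_convergence[where w = "\<lambda>_. 1"])
    show "AE \<omega> in M. (\<lambda>n. discount (truncated_rate (l\<^sup>2 / 2) (real n)) t \<omega>)
        \<longlonglongrightarrow> discount (\<lambda>x. l\<^sup>2 / 2 * clock_rate x) t \<omega>"
    proof (rule AE_I2)
      fix \<omega> assume \<omega>: "\<omega> \<in> space M"
      have "continuous_on {0..t} (\<lambda>s. 1 * clock_rate (W s \<omega>))"
        by (rule continuous_fun_path[OF clock_rate_continuous \<omega>]) auto
      then have "compact ((\<lambda>s. clock_rate (W s \<omega>)) ` {0..t})"
        by (intro compact_continuous_image) auto
      then have "\<exists>B. \<forall>s\<in>{0..t}. \<bar>clock_rate (W s \<omega>)\<bar> \<le> B"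
        using compact_imp_bounded[of "(\<lambda>s. clock_rate (W s \<omega>)) ` {0..t}"] by (auto simp: bounded_iff)
      then obtain B where B: "\<And>s. s \<in> {0..t} \<Longrightarrow> \<bar>clock_rate (W s \<omega>)\<bar> \<le> B" by blast
      obtain n0 where n0: "B \<le> real n0" using real_arch_simple by blast
      show "(\<lambda>n. discount (truncated_rate (l\<^sup>2 / 2) (real n)) t \<omega>)
        \<longlonglongrightarrow> discount (\<lambda>x. l\<^sup>2 / 2 * clock_rate x) t \<omega>"
      proof (rule tendsto_eventually, rule eventually_sequentiallyI[of n0])
        fix n assume n: "n0 \<le> n"
        have "integral {0..t} (\<lambda>s. truncated_rate (l\<^sup>2 / 2) (real n) (W s \<omega>))
            = integral {0..t} (\<lambda>s. l\<^sup>2 / 2 * clock_rate (W s \<omega>))"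
        proof (rule integral_cong)
          fix s assume "s \<in> {0..t}"
          then have "clock_rate (W s \<omega>) \<le> real n" using B[of s] n0 n by linarith
          then show "truncated_rate (l\<^sup>2 / 2) (real n) (W s \<omega>) = l\<^sup>2 / 2 * clock_rate (W s \<omega>)"
            by (simp add: truncated_rate_def)
        qed
        then show "discount (truncated_rate (l\<^sup>2 / 2) (real n)) t \<omega> = discount (\<lambda>x. l\<^sup>2 / 2 * clock_rate x) t \<omega>"
          by (simp add: discount_def)
      qed
    qed
    show "AE \<omega> in M. norm (discount (truncated_rate (l\<^sup>2 / 2) (real n)) t \<omega>) \<le> 1" for n
      using abs_discount_le_1[OF truncated_rate_continuous truncated_rate_bounds(1) _ t] by (intro AE_I2) simp
  qed (use t in \<open>(intro discount_measurable truncated_rate_continuous clock_rate_continuous; assumption)+, simp\<close>)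
  then show ?thesis by (rule LIMSEQ_le_const) (use n in auto)
qed

text \<open>Truncating the rate increases the discount factor, so only the limit \<open>N \<rightarrow> \<infinity>\<close> has to be taken. It
  uses \<open>(N / 3) (1 - (1 - w / N) ^ 3) \<ge> w - w\<^sup>2 / N\<close>.\<close>

lemma laplace_upper:
  assumes l: "0 < l" and \<delta>: "0 < \<delta>" and T: "0 < T"
  shows "expectation (\<lambda>\<omega>. discount (\<lambda>x. l\<^sup>2 / 2 * clock_rate x) T \<omega>)
     \<le> exp (- l * w0) + l * \<delta> + 1 / (2 * l\<^sup>2 * \<delta>\<^sup>2) / T"
proof (rule LIMSEQ_le_const)
  let ?N = "\<lambda>m. real (Suc m)"
  have i: "(\<lambda>m. 1 / ?N m) \<longlonglongrightarrow> 0" using LIMSEQ_inverse_real_of_nat by (simp add: inverse_eq_divide)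
  have "(\<lambda>m. exp (- (l - 1 / ?N m) * (w0 - w0\<^sup>2 * (1 / ?N m))) + l * \<delta> + 1 / (2 * l\<^sup>2 * \<delta>\<^sup>2) / T)
     \<longlonglongrightarrow> exp (- (l - 0) * (w0 - w0\<^sup>2 * 0)) + l * \<delta> + 1 / (2 * l\<^sup>2 * \<delta>\<^sup>2) / T"
    by (intro tendsto_add tendsto_exp tendsto_mult tendsto_minus tendsto_diff i tendsto_const)
  then show "(\<lambda>m. exp (- (l - 1 / ?N m) * (w0 - w0\<^sup>2 * (1 / ?N m))) + l * \<delta> + 1 / (2 * l\<^sup>2 * \<delta>\<^sup>2) / T)
     \<longlonglongrightarrow> exp (- l * w0) + l * \<delta> + 1 / (2 * l\<^sup>2 * \<delta>\<^sup>2) / T" by simp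
  obtain m0 where m0: "max w0 (1 / l) \<le> real m0" using real_arch_simple by blast
  have "expectation (\<lambda>\<omega>. discount (\<lambda>x. l\<^sup>2 / 2 * clock_rate x) T \<omega>)
      \<le> exp (- (l - 1 / ?N m) * (w0 - w0\<^sup>2 * (1 / ?N m))) + l * \<delta> + 1 / (2 * l\<^sup>2 * \<delta>\<^sup>2) / T"
    if m: "m0 \<le> m" for m
  proof -
    define N where "N = ?N m"
    have N: "0 < N" "w0 \<le> N" "1 / l \<le> N" using m m0 by (auto simp: N_def)
    then have N': "1 / N \<le> l" using l by (simp add: field_simps)
    obtain n where n: "0 \<le> n" "expectation (\<lambda>\<omega>. 1 * discount (truncated_rate (l\<^sup>2 / 2) n) T \<omega>)
      \<le> exp (- (l - 1 / N) * (N / 3 * (1 - pos_cube (1 - w0 / N)))) + l * \<delta> + 1 / (2 * l\<^sup>2 * \<delta>\<^sup>2) / T"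
      using discounted_supersolution[OF l N(1) N' \<delta> T] by blast
    have "pos_cube (1 - w0 / N) = (1 - w0 / N) ^ 3" using N by (simp add: pos_cube_def max_absorb2)
    moreover have "N / 3 * (1 - (1 - w0 / N) ^ 3) = w0 - w0\<^sup>2 / N + w0 ^ 3 / (3 * N\<^sup>2)"
      using N(1) by (simp add: power2_eq_square power3_eq_cube field_simps)
    moreover have "0 \<le> w0 ^ 3 / (3 * N\<^sup>2)" using w0_pos by simp
    ultimately have "w0 - w0\<^sup>2 * (1 / N) \<le> N / 3 * (1 - pos_cube (1 - w0 / N))" by simp
    then have "(l - 1 / N) * (w0 - w0\<^sup>2 * (1 / N)) \<le> (l - 1 / N) * (N / 3 * (1 - pos_cube (1 - w0 / N)))"
      using N' by (intro mult_left_mono) auto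
    then have e: "exp (- (l - 1 / N) * (N / 3 * (1 - pos_cube (1 - w0 / N)))) \<le> exp (- (l - 1 / N) * (w0 - w0\<^sup>2 * (1 / N)))"
      unfolding exp_le_cancel_iff mult_minus_left by simp
    have "expectation (\<lambda>\<omega>. discount (\<lambda>x. l\<^sup>2 / 2 * clock_rate x) T \<omega>)
      \<le> expectation (\<lambda>\<omega>. 1 * discount (truncated_rate (l\<^sup>2 / 2) n) T \<omega>)"
    proof (rule integral_mono)
      show "integrable M (discount (\<lambda>x. l\<^sup>2 / 2 * clock_rate x) T)"
        using integrable_fun_discount[OF _ _ clock_rate_continuous, of "\<lambda>_. 1" 1 "l\<^sup>2 / 2" T T] T clock_rate_nonneg
        by simp
      show "integrable M (\<lambda>\<omega>. 1 * discount (truncated_rate (l\<^sup>2 / 2) n) T \<omega>)"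
        using integrable_fun_discount[OF _ _ truncated_rate_continuous, of "\<lambda>_. 1" 1 "l\<^sup>2 / 2" n T T] T n(1)
          truncated_rate_bounds(1) by simp
      show "discount (\<lambda>x. l\<^sup>2 / 2 * clock_rate x) T \<omega> \<le> 1 * discount (truncated_rate (l\<^sup>2 / 2) n) T \<omega>"
        if "\<omega> \<in> space M" for \<omega>
        using discount_mono[OF truncated_rate_continuous clock_rate_continuous truncated_rate_bounds(3) that, of "l\<^sup>2 / 2" n T]
          T n(1) by simp
    qed
    then show ?thesis using n(2) e unfolding N_def by linarith
  qed
  then show "\<exists>M0. \<forall>m\<ge>M0. expectation (\<lambda>\<omega>. discount (\<lambda>x. l\<^sup>2 / 2 * clock_rate x) T \<omega>)
      \<le> exp (- (l - 1 / ?N m) * (w0 - w0\<^sup>2 * (1 / ?N m))) + l * \<delta> + 1 / (2 * l\<^sup>2 * \<delta>\<^sup>2) / T"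
    by blast
qed

lemma laplace_limit:
  assumes l: "0 < l"
  shows "((\<lambda>t. expectation (\<lambda>\<omega>. discount (\<lambda>x. l\<^sup>2 / 2 * clock_rate x) t \<omega>)) \<longlongrightarrow> exp (- l * w0)) at_top"
proof (rule tendstoI)
  fix e :: real assume e: "0 < e"
  define \<delta> where "\<delta> = e / (2 * l)"
  have \<delta>: "0 < \<delta>" "l * \<delta> = e / 2" using e l by (auto simp: \<delta>_def)
  define C where "C = 1 / (2 * l\<^sup>2 * \<delta>\<^sup>2)"
  have "\<forall>\<^sub>F t in at_top. max 0 (2 * C / e) < (t::real)" by (rule eventually_gt_at_top)
  then show "\<forall>\<^sub>F t in at_top. dist (expectation (\<lambda>\<omega>. discount (\<lambda>x. l\<^sup>2 / 2 * clock_rate x) t \<omega>)) (exp (- l * w0)) < e"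
  proof eventually_elim
    case (elim t)
    then have t: "0 < t" "C / t < e / 2" using e by (auto simp: field_simps)
    show ?case
      using laplace_lower[OF l less_imp_le[OF t(1)]] laplace_upper[OF l \<delta>(1) t(1), folded C_def] t \<delta>(2)
      unfolding dist_real_def abs_less_iff by linarith
  qed
qed

end

section \<open>Independent time changes of Brownian motion\<close>

lemma brownian_char:
  assumes "prob_space M" "standard_brownian_motion M \<beta>" "0 \<le> a"
  shows "(\<integral>\<omega>. iexp (u * \<beta> a \<omega>) \<partial>M) = exp (- (u\<^sup>2 * a) / 2)"
proof -
  interpret prob_space M by fact
  have zero: "\<beta> 0 \<omega> = 0" if "\<omega> \<in> space M" for \<omega>
    using assms(2) that by (simp add: standard_brownian_motion_def)
  show ?thesis
  proof (cases "a = 0")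
    case True
    have "(\<integral>\<omega>. iexp (u * \<beta> a \<omega>) \<partial>M) = (\<integral>\<omega>. 1 \<partial>M)"
      by (rule Bochner_Integration.integral_cong) (auto simp: True zero)
    then show ?thesis using True by (simp add: prob_space)
  next
    case False
    then have a: "0 < a" using assms(3) by simp
    define Y where "Y = (\<lambda>\<omega>. (\<beta> a \<omega> - \<beta> 0 \<omega> - 0) / sqrt a)"
    have "distributed M lborel (\<lambda>\<omega>. \<beta> a \<omega> - \<beta> 0 \<omega>) (normal_density 0 (sqrt (a - 0)))"
      using assms(2) a unfolding standard_brownian_motion_def by blast
    then have dY: "distributed M lborel Y std_normal_density"
      using normal_standard_normal_convert[of "sqrt a" "\<lambda>\<omega>. \<beta> a \<omega> - \<beta> 0 \<omega>" 0] a by (simp add: Y_def)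
    then have Ym: "Y \<in> borel_measurable M" by (auto simp: distributed_def)
    have "distr M lborel Y = std_normal_distribution"
      using distributed_distr_eq_density[OF dY] by simp
    then have "char std_normal_distribution (u * sqrt a) = (\<integral>\<omega>. iexp (u * sqrt a * Y \<omega>) \<partial>M)"
      using Ym unfolding char_def by (subst integral_distr[symmetric, of _ M lborel]) auto
    also have "\<dots> = (\<integral>\<omega>. iexp (u * \<beta> a \<omega>) \<partial>M)"
      by (rule Bochner_Integration.integral_cong) (use a zero in \<open>auto simp: Y_def\<close>)
    finally show ?thesis
      using a unfolding char_std_normal_distribution by (simp add: power_mult_distrib)
  qed
qed

text \<open>Used to pass from the independence of two whole processes to that of two functionals of
  them.\<close>

lemma (in prob_space) indep_var_vimage_algebra:
  assumes ind: "indep_var S X T Y"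
    and f: "f \<in> borel_measurable (vimage_algebra (space M) X S)"
    and g: "g \<in> borel_measurable (vimage_algebra (space M) Y T)"
  shows "indep_var borel f borel g"
proof -
  have X: "X \<in> measurable M S" and Y: "Y \<in> measurable M T"
    and ind': "indep_set (sigma_sets (space M) { X -` A \<inter> space M | A. A \<in> sets S})
      (sigma_sets (space M) { Y -` A \<inter> space M | A. A \<in> sets T})"
    using ind unfolding indep_var_eq by auto
  have sub: "sigma_sets (space M) {h -` A \<inter> space M | A. A \<in> sets borel}
      \<subseteq> sigma_sets (space M) { Z -` A \<inter> space M | A. A \<in> sets R}"
    if "h \<in> borel_measurable (vimage_algebra (space M) Z R)" for h :: "'a \<Rightarrow> 'c::topological_space" and Z :: "'a \<Rightarrow> 'd" and R
  proof (rule sigma_sets_mono)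
    show "{h -` A \<inter> space M | A. A \<in> sets borel} \<subseteq> sigma_sets (space M) { Z -` A \<inter> space M | A. A \<in> sets R}"
      using measurable_sets[OF that] by (auto simp: sets_vimage_algebra)
  qed
  have vsub: "h \<in> borel_measurable M" if "h \<in> borel_measurable (vimage_algebra (space M) Z R)" "Z \<in> measurable M R"
    for h :: "'a \<Rightarrow> 'c::topological_space" and Z :: "'a \<Rightarrow> 'd" and R
  proof (rule measurable_from_subalg[OF _ that(1)])
    show "subalgebra M (vimage_algebra (space M) Z R)"
      unfolding subalgebra_def
      using measurable_sets[OF that(2)] by (auto simp: sets_vimage_algebra intro!: sets.sigma_sets_subset)
  qed
  have "indep_set (sigma_sets (space M) {f -` A \<inter> space M | A. A \<in> sets borel})
      (sigma_sets (space M) {g -` A \<inter> space M | A. A \<in> sets borel})"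
    using ind' sub[OF f] sub[OF g] unfolding indep_sets2_eq by blast
  then show ?thesis
    unfolding indep_var_eq using vsub[OF f X] vsub[OF g Y] by simp
qed

text \<open>The map from a path and a time to the value of the path is not measurable for the product
  sigma-algebra, so independence is applied at finitely many times only: \<open>A\<close> is replaced by
  \<open>j / Suc m\<close>, where \<open>j\<close> is the integral part of \<open>Suc m * min A m\<close>. This takes finitely many values, on each of
  which the Gaussian characteristic function factors out, and it tends to \<open>A\<close>.\<close>

lemma time_change_char:
  assumes M: "prob_space M" and bm: "standard_brownian_motion M \<beta>"
    and A: "A \<in> borel_measurable M" "\<And>\<omega>. \<omega> \<in> space M \<Longrightarrow> 0 \<le> A \<omega>"
    and ind: "\<And>a. 0 \<le> a \<Longrightarrow> prob_space.indep_var M borel A borel (\<beta> a)"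
  shows "(\<lambda>\<omega>. \<beta> (A \<omega>) \<omega>) \<in> borel_measurable M"
    and "(\<integral>\<omega>. iexp (u * \<beta> (A \<omega>) \<omega>) \<partial>M) = (\<integral>\<omega>. exp (- (u\<^sup>2 / 2 * A \<omega>)) \<partial>M)"
proof -
  interpret prob_space M by fact
  have \<beta>m [measurable]: "\<beta> a \<in> borel_measurable M" if "0 \<le> a" for a
    using bm that by (simp add: standard_brownian_motion_def continuous_process_def)
  have \<beta>c: "continuous_on {0..} (\<lambda>t. \<beta> t \<omega>)" if "\<omega> \<in> space M" for \<omega>
    using bm that by (simp add: standard_brownian_motion_def continuous_process_def)
  note [measurable] = A(1)
  define j where "j = (\<lambda>m a. nat \<lfloor>real (Suc m) * min a (real m)\<rfloor>)"
  define c where "c = (\<lambda>m k. real k / real (Suc m))"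
  have c0: "0 \<le> c m k" for m k by (simp add: c_def)
  have jm [measurable]: "j m \<in> measurable borel (count_space UNIV)" for m
    unfolding j_def by measurable
  have jle: "j m a \<le> m * Suc m" for m a
  proof -
    have "real (Suc m) * min a (real m) \<le> real (Suc m) * real m" by (intro mult_left_mono) auto
    then have "\<lfloor>real (Suc m) * min a (real m)\<rfloor> \<le> \<lfloor>real (Suc m * m)\<rfloor>" unfolding of_nat_mult by (rule floor_mono)
    also have "\<dots> = int (Suc m * m)" by (rule floor_of_nat)
    finally show ?thesis unfolding j_def by (simp add: nat_le_iff mult.commute)
  qed
  have clim: "(\<lambda>m. c m (j m a)) \<longlonglongrightarrow> a" if "0 \<le> a" for a
  proof -
    obtain n0 where "a \<le> real n0" using real_arch_simple by blast
    then have "(\<lambda>m. min a (real m)) \<longlonglongrightarrow> a"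
      by (intro tendsto_eventually eventually_sequentiallyI[of n0]) (rule min_absorb1, linarith)
    from floor_grid_tendsto[OF this] show ?thesis
      using that unfolding c_def j_def by (simp add: of_nat_nat del: of_nat_Suc)
  qed
  have lim\<beta>: "(\<lambda>m. \<beta> (c m (j m (A \<omega>))) \<omega>) \<longlonglongrightarrow> \<beta> (A \<omega>) \<omega>" if "\<omega> \<in> space M" for \<omega>
    using continuous_on_tendsto_compose[OF \<beta>c[OF that] clim[OF A(2)[OF that]]] A(2)[OF that] c0 by auto
  have \<beta>jm: "(\<lambda>\<omega>. \<beta> (c m (j m (A \<omega>))) \<omega>) \<in> borel_measurable M" for m
    by (rule measurable_compose_countable[where f = "\<lambda>k \<omega>. \<beta> (c m k) \<omega>"]) (use c0 in measurable)
  show \<beta>Am: "(\<lambda>\<omega>. \<beta> (A \<omega>) \<omega>) \<in> borel_measurable M"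
    by (rule borel_measurable_LIMSEQ_real[OF lim\<beta> \<beta>jm])
  define I where "I = (\<lambda>m k \<omega>. if j m (A \<omega>) = k then 1 else 0 :: complex)"
  have Im [measurable]: "I m k \<in> borel_measurable M" for m k unfolding I_def by measurable
  have Iint: "integrable M (I m k)" for m k
    by (rule integrable_const_bound[of _ 1]) (auto simp: I_def)
  have Ndef: "h (j m (A \<omega>)) = (\<Sum>k\<le>m * Suc m. I m k \<omega> * h k)" for m \<omega> and h :: "nat \<Rightarrow> complex"
  proof -
    have "(\<Sum>k\<le>m * Suc m. I m k \<omega> * h k) = (\<Sum>k\<le>m * Suc m. if j m (A \<omega>) = k then h k else 0)"
      by (rule sum.cong) (auto simp: I_def)
    then show ?thesis using jle[of m "A \<omega>"] by (simp add: sum.delta')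
  qed
  have eint: "integrable M (\<lambda>\<omega>. iexp (u * \<beta> a \<omega>))" if "0 \<le> a" for a
    by (rule integrable_const_bound[of _ 1]) (use that in auto)
  have prod: "integrable M (\<lambda>\<omega>. I m k \<omega> * iexp (u * \<beta> (c m k) \<omega>))"
      "(\<integral>\<omega>. I m k \<omega> * iexp (u * \<beta> (c m k) \<omega>) \<partial>M) = (\<integral>\<omega>. I m k \<omega> * exp (- (u\<^sup>2 * c m k) / 2) \<partial>M)" for m k
  proof -
    have "indep_var borel ((\<lambda>a. if j m a = k then 1 else 0 :: complex) \<circ> A) borel ((\<lambda>b. iexp (u * b)) \<circ> \<beta> (c m k))"
      by (rule indep_var_compose[OF ind[OF c0]]) measurable
    then have iv: "indep_var borel (I m k) borel (\<lambda>\<omega>. iexp (u * \<beta> (c m k) \<omega>))"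
      by (simp add: comp_def I_def)
    show "integrable M (\<lambda>\<omega>. I m k \<omega> * iexp (u * \<beta> (c m k) \<omega>))"
      by (rule indep_var_integrable[OF iv Iint eint[OF c0]])
    show "(\<integral>\<omega>. I m k \<omega> * iexp (u * \<beta> (c m k) \<omega>) \<partial>M) = (\<integral>\<omega>. I m k \<omega> * exp (- (u\<^sup>2 * c m k) / 2) \<partial>M)"
      unfolding indep_var_lebesgue_integral[OF iv Iint eint[OF c0]] brownian_char[OF M bm c0] by simp
  qed
  have step: "(\<integral>\<omega>. iexp (u * \<beta> (c m (j m (A \<omega>))) \<omega>) \<partial>M) = (\<integral>\<omega>. of_real (exp (- (u\<^sup>2 * c m (j m (A \<omega>))) / 2)) \<partial>M)" for m
  proof -
    have "(\<integral>\<omega>. iexp (u * \<beta> (c m (j m (A \<omega>))) \<omega>) \<partial>M) = (\<integral>\<omega>. (\<Sum>k\<le>m * Suc m. I m k \<omega> * iexp (u * \<beta> (c m k) \<omega>)) \<partial>M)"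
      by (subst Ndef[symmetric]) simp
    also have "\<dots> = (\<Sum>k\<le>m * Suc m. \<integral>\<omega>. I m k \<omega> * iexp (u * \<beta> (c m k) \<omega>) \<partial>M)"
      by (rule Bochner_Integration.integral_sum) (rule prod)
    also have "\<dots> = (\<Sum>k\<le>m * Suc m. \<integral>\<omega>. I m k \<omega> * exp (- (u\<^sup>2 * c m k) / 2) \<partial>M)"
      unfolding prod(2) ..
    also have "\<dots> = (\<integral>\<omega>. (\<Sum>k\<le>m * Suc m. I m k \<omega> * exp (- (u\<^sup>2 * c m k) / 2)) \<partial>M)"
      by (rule Bochner_Integration.integral_sum[symmetric]) (use Iint in auto)
    also have "\<dots> = (\<integral>\<omega>. of_real (exp (- (u\<^sup>2 * c m (j m (A \<omega>))) / 2)) \<partial>M)"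
      unfolding Ndef[symmetric] ..
    finally show ?thesis .
  qed
  have L1: "(\<lambda>m. \<integral>\<omega>. iexp (u * \<beta> (c m (j m (A \<omega>))) \<omega>) \<partial>M) \<longlonglongrightarrow> (\<integral>\<omega>. iexp (u * \<beta> (A \<omega>) \<omega>) \<partial>M)"
  proof (rule integral_dominated_convergence[where w = "\<lambda>_. 1"])
    show "AE \<omega> in M. (\<lambda>m. iexp (u * \<beta> (c m (j m (A \<omega>))) \<omega>)) \<longlonglongrightarrow> iexp (u * \<beta> (A \<omega>) \<omega>)"
      by (intro AE_I2 tendsto_intros lim\<beta>)
  qed (use \<beta>jm \<beta>Am in auto)
  have L2: "(\<lambda>m. \<integral>\<omega>. of_real (exp (- (u\<^sup>2 * c m (j m (A \<omega>))) / 2)) \<partial>M)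
      \<longlonglongrightarrow> (\<integral>\<omega>. of_real (exp (- (u\<^sup>2 * A \<omega>) / 2)) \<partial>M :: complex)"
  proof (rule integral_dominated_convergence[where w = "\<lambda>_. 1"])
    show "AE \<omega> in M. (\<lambda>m. of_real (exp (- (u\<^sup>2 * c m (j m (A \<omega>))) / 2)) :: complex)
        \<longlonglongrightarrow> of_real (exp (- (u\<^sup>2 * A \<omega>) / 2))"
      by (intro AE_I2 tendsto_intros clim A(2)) auto
    show "AE \<omega> in M. norm (of_real (exp (- (u\<^sup>2 * c m (j m (A \<omega>))) / 2)) :: complex) \<le> 1" for m
      using c0 by (intro AE_I2) simp
    show "(\<lambda>\<omega>. of_real (exp (- (u\<^sup>2 * c m (j m (A \<omega>))) / 2)) :: complex) \<in> borel_measurable M" for m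
      unfolding c_def by measurable
  qed auto
  have "(\<integral>\<omega>. iexp (u * \<beta> (A \<omega>) \<omega>) \<partial>M) = (\<integral>\<omega>. of_real (exp (- (u\<^sup>2 * A \<omega>) / 2)) \<partial>M)"
    using LIMSEQ_unique[OF L1 L2[folded step]] .
  also have "\<dots> = of_real (\<integral>\<omega>. exp (- (u\<^sup>2 * A \<omega>) / 2) \<partial>M)" by (rule integral_complex_of_real)
  finally show "(\<integral>\<omega>. iexp (u * \<beta> (A \<omega>) \<omega>) \<partial>M) = (\<integral>\<omega>. exp (- (u\<^sup>2 / 2 * A \<omega>)) \<partial>M)" by simp
qed

section \<open>From the hyperbolic Jacobi diffusion to the Cauchy law\<close>

lemma ln_coth_measurable: "(\<lambda>x. ln (coth x)) \<in> borel_measurable borel"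
proof -
  have [measurable]: "(cosh :: real \<Rightarrow> real) \<in> borel_measurable borel" "(sinh :: real \<Rightarrow> real) \<in> borel_measurable borel"
    by (auto intro!: borel_measurable_continuous_onI continuous_intros)
  show ?thesis unfolding coth_def by measurable
qed

lemma natural_filtration_measurable:
  assumes "0 \<le> s" "s \<le> t"
  shows "X s \<in> borel_measurable (natural_filtration M X t)"
proof -
  define G where "G = (\<Union>u\<in>{0..t}. {X u -` B \<inter> space M | B. B \<in> sets borel})"
  have G: "G \<subseteq> Pow (space M)" by (auto simp: G_def)
  show ?thesis
  proof (rule measurableI)
    show "X s -` B \<inter> space (natural_filtration M X t) \<in> sets (natural_filtration M X t)" if "B \<in> sets borel" for B
    proof -
      have "X s -` B \<inter> space M \<in> G" using assms that by (auto simp: G_def intro!: bexI[of _ s])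
      then show ?thesis
        unfolding natural_filtration_def G_def[symmetric] sets_measure_of[OF G] space_measure_of[OF G]
        by (rule sigma_sets.Basic)
    qed
  qed simp
qed

lemma natural_filtration_subalgebra:
  assumes "\<And>u. 0 \<le> u \<Longrightarrow> u \<le> t \<Longrightarrow> X u \<in> borel_measurable M"
  shows "subalgebra M (natural_filtration M X t)"
proof -
  define G where "G = (\<Union>u\<in>{0..t}. {X u -` B \<inter> space M | B. B \<in> sets borel})"
  have G: "G \<subseteq> Pow (space M)" by (auto simp: G_def)
  have "G \<subseteq> sets M" using assms unfolding G_def by (auto intro: measurable_sets)
  then have "sigma_sets (space M) G \<subseteq> sets M" by (rule sets.sigma_sets_subset)
  then show ?thesis
    unfolding subalgebra_def natural_filtration_def G_def[symmetric] sets_measure_of[OF G] space_measure_of[OF G]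
    by simp
qed

lemma (in prob_space) martingale_increment:
  assumes mart: "martingale_wrt M F X" and sub: "subalgebra M (F s)" and st: "0 \<le> s" "s \<le> t"
    and Z: "Z \<in> borel_measurable (F s)" "\<And>\<omega>. \<omega> \<in> space M \<Longrightarrow> \<bar>Z \<omega>\<bar> \<le> 1"
  shows "expectation (\<lambda>\<omega>. (X t \<omega> - X s \<omega>) * Z \<omega>) = 0"
proof -
  interpret finite_measure_subalgebra M "F s" by unfold_locales (rule sub)
  have ZM: "Z \<in> borel_measurable M" using measurable_from_subalg[OF sub Z(1)] .
  have X: "integrable M (X u)" if "0 \<le> u" for u using mart that by (simp add: martingale_wrt_def)
  have ZX: "integrable M (\<lambda>\<omega>. Z \<omega> * X u \<omega>)" if "0 \<le> u" for u
  proof (rule Bochner_Integration.integrable_bound[OF X[OF that]])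
    show "AE \<omega> in M. norm (Z \<omega> * X u \<omega>) \<le> norm (X u \<omega>)"
    proof (rule AE_I2)
      fix \<omega> assume "\<omega> \<in> space M"
      from mult_right_mono[OF Z(2)[OF this], of "\<bar>X u \<omega>\<bar>"]
      show "norm (Z \<omega> * X u \<omega>) \<le> norm (X u \<omega>)" by (simp add: abs_mult)
    qed
  qed (use ZM X[OF that] in auto)
  have t0: "0 \<le> t" using st by simp
  have "expectation (\<lambda>\<omega>. Z \<omega> * X t \<omega>) = expectation (\<lambda>\<omega>. Z \<omega> * real_cond_exp M (F s) (X t) \<omega>)"
    using real_cond_exp_intg(2)[OF ZX[OF t0] Z(1)] X[OF t0] by auto
  also have "\<dots> = expectation (\<lambda>\<omega>. Z \<omega> * X s \<omega>)"
  proof (rule integral_cong_AE)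
    have "AE \<omega> in M. real_cond_exp M (F s) (X t) \<omega> = X s \<omega>"
      using mart st by (auto simp: martingale_wrt_def)
    then show "AE \<omega> in M. Z \<omega> * real_cond_exp M (F s) (X t) \<omega> = Z \<omega> * X s \<omega>" by auto
  qed (use ZM X[OF st(1)] in auto)
  finally have "expectation (\<lambda>\<omega>. Z \<omega> * X t \<omega> - Z \<omega> * X s \<omega>) = 0"
    using ZX[OF t0] ZX[OF st(1)] by (simp add: Bochner_Integration.integral_diff)
  then show ?thesis by (simp add: algebra_simps)
qed

text \<open>Test functions of \<open>W\<close> with compact support in the open half-line are test functions of \<open>r\<close>.\<close>

lemma jacobi_log_martingale_problem:
  assumes M: "prob_space M" and r: "hyperbolic_jacobi_diffusion M r0 r"
  shows "log_martingale_problem M (natural_filtration M r) (\<lambda>t \<omega>. ln (coth (r t \<omega>))) (ln (coth r0))"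
proof -
  interpret prob_space M by fact
  have rm: "r t \<in> borel_measurable M" if "0 \<le> t" for t
    using r that by (simp add: hyperbolic_jacobi_diffusion_def continuous_process_def)
  have rc: "continuous_on {0..} (\<lambda>t. r t \<omega>)" and r00: "r 0 \<omega> = r0" and rpos: "\<And>t. 0 \<le> t \<Longrightarrow> 0 < r t \<omega>"
    if "\<omega> \<in> space M" for \<omega>
    using r that by (auto simp: hyperbolic_jacobi_diffusion_def continuous_process_def)
  have sub: "subalgebra M (natural_filtration M r t)" if "0 \<le> t" for t
    by (rule natural_filtration_subalgebra) (rule rm)
  have wc: "continuous_on {0..} (\<lambda>t. ln (coth (r t \<omega>)))" if \<omega>: "\<omega> \<in> space M" for \<omega>
  proof (rule continuous_on_compose2[OF _ rc[OF \<omega>], of "{0<..}"])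
    show "continuous_on {0<..} (\<lambda>x. ln (coth x))"
      by (rule continuous_at_imp_continuous_on) (auto intro: DERIV_isCont DERIV_ln_coth)
  qed (use rpos[OF \<omega>] in auto)
  show ?thesis
  proof (unfold_locales)
    fix \<kappa> \<kappa>' \<kappa>'' :: "real \<Rightarrow> real" and a b s t :: real and Z :: "'a \<Rightarrow> real"
    assume C: "C2_with \<kappa> \<kappa>' \<kappa>''" and a: "0 < a" and supp: "\<And>x. x \<notin> {a..b} \<Longrightarrow> \<kappa> x = 0"
      and st: "0 \<le> s" "s \<le> t" and Z: "Z \<in> borel_measurable (natural_filtration M r s)"
      "\<And>\<omega>. \<omega> \<in> space M \<Longrightarrow> \<bar>Z \<omega>\<bar> \<le> 1"
    define f where "f = (\<lambda>x. if 0 < x then \<kappa> (ln (coth x)) else 0)"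
    define g where "g = (\<lambda>x. 2 * (sinh x)\<^sup>2 * \<kappa>'' x)"
    have f: "f \<in> C2_compact_support_pos"
      and gen: "\<And>x. 0 < x \<Longrightarrow> hyperbolic_jacobi_generator f x = g (ln (coth x))"
      using generator_ln_coth[OF C a supp] unfolding f_def g_def by auto
    define X where "X = (\<lambda>t \<omega>. f (r t \<omega>) - f r0 - (LBINT s:{0..t}. hyperbolic_jacobi_generator f (r s \<omega>)))"
    have "martingale_wrt M (natural_filtration M r) X"
      using r f unfolding hyperbolic_jacobi_diffusion_def X_def by blast
    from martingale_increment[OF this sub[OF st(1)] st Z]
    have X0: "expectation (\<lambda>\<omega>. (X t \<omega> - X s \<omega>) * Z \<omega>) = 0" .
    have gc: "continuous_on {0..} (\<lambda>t. g (ln (coth (r t \<omega>))))" if "\<omega> \<in> space M" for \<omega>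
    proof (rule continuous_on_compose2[OF _ wc[OF that]])
      show "continuous_on UNIV g" unfolding g_def using C2_withD(3)[OF C] by (intro continuous_intros)
    qed auto
    have X: "X u \<omega> = \<kappa> (ln (coth (r u \<omega>))) - f r0 - integral {0..u} (\<lambda>s. g (ln (coth (r s \<omega>))))"
      if \<omega>: "\<omega> \<in> space M" and u: "0 \<le> u" for u \<omega>
    proof -
      have "(LBINT s:{0..u}. hyperbolic_jacobi_generator f (r s \<omega>)) = (LBINT s:{0..u}. g (ln (coth (r s \<omega>))))"
        by (rule set_lebesgue_integral_cong) (use gen rpos[OF \<omega>] in auto)
      also have "\<dots> = integral {0..u} (\<lambda>s. g (ln (coth (r s \<omega>))))"
        by (rule set_lebesgue_integral_continuous_eq) (rule continuous_on_subset[OF gc[OF \<omega>]], auto)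
      finally show ?thesis using rpos[OF \<omega> u] by (simp add: X_def f_def)
    qed
    have "expectation (\<lambda>\<omega>. (X t \<omega> - X s \<omega>) * Z \<omega>) = expectation (\<lambda>\<omega>. (\<kappa> (ln (coth (r t \<omega>))) - \<kappa> (ln (coth (r s \<omega>)))
        - integral {s..t} (\<lambda>u. g (ln (coth (r u \<omega>))))) * Z \<omega>)"
    proof (rule Bochner_Integration.integral_cong[OF refl])
      fix \<omega> assume \<omega>: "\<omega> \<in> space M"
      show "(X t \<omega> - X s \<omega>) * Z \<omega> = (\<kappa> (ln (coth (r t \<omega>))) - \<kappa> (ln (coth (r s \<omega>)))
        - integral {s..t} (\<lambda>u. g (ln (coth (r u \<omega>))))) * Z \<omega>"
        using path_integral_diff[OF gc[OF \<omega>] st] X[OF \<omega>] st by simp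
    qed
    then show "expectation (\<lambda>\<omega>. (\<kappa> (ln (coth (r t \<omega>))) - \<kappa> (ln (coth (r s \<omega>)))
        - integral {s..t} (\<lambda>u. 2 * (sinh (ln (coth (r u \<omega>))))\<^sup>2 * \<kappa>'' (ln (coth (r u \<omega>))))) * Z \<omega>) = 0"
      using X0 by (simp add: g_def)
  qed (use sub wc rpos r00 ln_coth_pos measurable_compose[OF natural_filtration_measurable ln_coth_measurable] in auto)
qed

lemma winding_clock_props:
  assumes M: "prob_space M" and r: "hyperbolic_jacobi_diffusion M r0 r"
  shows "\<omega> \<in> space M \<Longrightarrow> 0 \<le> t \<Longrightarrow> winding_clock r t \<omega> = integral {0..t} (\<lambda>s. clock_rate (ln (coth (r s \<omega>))))"
    and "\<omega> \<in> space M \<Longrightarrow> 0 \<le> s \<Longrightarrow> s \<le> t \<Longrightarrow> winding_clock r s \<omega> \<le> winding_clock r t \<omega>"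
    and "0 \<le> winding_clock r t \<omega>"
    and "winding_clock r t \<in> borel_measurable
      (vimage_algebra (space M) (\<lambda>\<omega>. \<lambda>t\<in>{0..}. r t \<omega>) (\<Pi>\<^sub>M t\<in>{0..}. borel))"
proof -
  interpret L: log_martingale_problem M "natural_filtration M r" "\<lambda>t \<omega>. ln (coth (r t \<omega>))" "ln (coth r0)"
    by (rule jacobi_log_martingale_problem[OF M r])
  define h where "h = (\<lambda>s \<omega>. clock_rate (ln (coth (r s \<omega>))))"
  have hc: "continuous_on {0..} (\<lambda>s. h s \<omega>)" if "\<omega> \<in> space M" for \<omega>
    using L.continuous_fun_path[OF clock_rate_continuous[of 1] that subset_refl] by (simp add: h_def)
  have rate: "4 / (sinh (2 * r s \<omega>))\<^sup>2 = h s \<omega>" if "\<omega> \<in> space M" "0 \<le> s" for s \<omega>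
  proof -
    have "0 < r s \<omega>" using r that by (auto simp: hyperbolic_jacobi_diffusion_def)
    then show ?thesis by (simp add: h_def clock_rate_def sinh_ln_coth power_divide)
  qed
  have eq: "winding_clock r t \<omega> = integral {0..t} (\<lambda>s. h s \<omega>)" if \<omega>: "\<omega> \<in> space M" for t \<omega>
  proof -
    have "winding_clock r t \<omega> = (LBINT s:{0..t}. h s \<omega>)"
      unfolding winding_clock_def by (rule set_lebesgue_integral_cong) (use rate[OF \<omega>] in auto)
    also have "\<dots> = integral {0..t} (\<lambda>s. h s \<omega>)"
      by (rule set_lebesgue_integral_continuous_eq) (rule continuous_on_subset[OF hc[OF \<omega>]], auto)
    finally show ?thesis .
  qed
  show "\<omega> \<in> space M \<Longrightarrow> 0 \<le> t \<Longrightarrow> winding_clock r t \<omega> = integral {0..t} (\<lambda>s. clock_rate (ln (coth (r s \<omega>))))"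
    using eq by (simp add: h_def)
  show "winding_clock r s \<omega> \<le> winding_clock r t \<omega>" if \<omega>: "\<omega> \<in> space M" and st: "0 \<le> s" "s \<le> t"
  proof -
    have "0 \<le> integral {s..t} (\<lambda>s. h s \<omega>)"
      by (rule integral_nonneg[OF integrable_continuous_real[OF continuous_on_subset[OF hc[OF \<omega>]]]])
        (use st clock_rate_nonneg in \<open>auto simp: h_def\<close>)
    then show ?thesis using path_integral_diff[OF hc[OF \<omega>] st] eq[OF \<omega>] by simp
  qed
  show "0 \<le> winding_clock r t \<omega>"
    unfolding winding_clock_def set_lebesgue_integral_def by (intro integral_nonneg_AE AE_I2) simp
  define N where "N = vimage_algebra (space M) (\<lambda>\<omega>. \<lambda>t\<in>{0..}. r t \<omega>) (\<Pi>\<^sub>M t\<in>{0..}. borel :: real measure)"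
  have spN: "space N = space M" by (simp add: N_def)
  have rN: "r s \<in> borel_measurable N" if "0 \<le> s" for s
  proof -
    have "(\<lambda>\<omega>. \<lambda>t\<in>{0..}. r t \<omega>) \<in> measurable N (\<Pi>\<^sub>M t\<in>{0..}. borel)"
      unfolding N_def by (rule measurable_vimage_algebra1) (auto simp: space_PiM)
    from measurable_compose[OF this measurable_component_singleton[of s]]
    show ?thesis using that by simp
  qed
  show "winding_clock r t \<in> borel_measurable N"
  proof (cases "0 \<le> t")
    case True
    have "(\<lambda>\<omega>. integral {0..t} (\<lambda>s. h s \<omega>)) \<in> borel_measurable N"
    proof (rule measurable_path_integral[OF _ _ True])
      have "(\<lambda>x. clock_rate (ln (coth x))) \<in> borel_measurable borel"
        using measurable_compose[OF ln_coth_measurable borel_measurable_continuous_onI[OF clock_rate_continuous[of 1]]] by simp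
      from measurable_compose[OF rN this] show "h s \<in> borel_measurable N" if "0 \<le> s" for s
        using that by (simp add: h_def)
      show "continuous_on {0..t} (\<lambda>s. h s \<omega>)" if "\<omega> \<in> space N" for \<omega>
        using hc[of \<omega>] that spN by (auto intro: continuous_on_subset)
    qed
    then show ?thesis by (subst measurable_cong[of _ _ "\<lambda>\<omega>. integral {0..t} (\<lambda>s. h s \<omega>)"]) (use eq spN in auto)
  next
    case False
    then have "winding_clock r t = (\<lambda>_. 0)" by (auto simp: winding_clock_def set_lebesgue_integral_def)
    then show ?thesis by simp
  qed
qed

lemma winding_char:
  assumes M: "prob_space M" and r: "hyperbolic_jacobi_diffusion M r0 r"
    and bm: "standard_brownian_motion M \<beta>" and ind: "independent_processes M r \<beta>"
  shows "CH1_winding r \<beta> t \<in> borel_measurable M"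
    and "(\<integral>\<omega>. iexp (u * CH1_winding r \<beta> t \<omega>) \<partial>M) = (\<integral>\<omega>. exp (- (u\<^sup>2 / 2 * winding_clock r t \<omega>)) \<partial>M)"
proof -
  interpret prob_space M by fact
  have ind': "indep_var (\<Pi>\<^sub>M t\<in>{0..}. borel) (\<lambda>\<omega>. \<lambda>t\<in>{0..}. r t \<omega>) (\<Pi>\<^sub>M t\<in>{0..}. borel) (\<lambda>\<omega>. \<lambda>t\<in>{0..}. \<beta> t \<omega>)"
    using ind by (simp add: independent_processes_def)
  have iv: "indep_var borel (winding_clock r t) borel (\<beta> a)" if a: "0 \<le> a" for a
  proof (rule indep_var_vimage_algebra[OF ind' winding_clock_props(4)[OF M r]])
    have "(\<lambda>\<omega>. \<lambda>t\<in>{0..}. \<beta> t \<omega>) \<in> measurable (vimage_algebra (space M) (\<lambda>\<omega>. \<lambda>t\<in>{0..}. \<beta> t \<omega>) (\<Pi>\<^sub>M t\<in>{0..}. borel)) (\<Pi>\<^sub>M t\<in>{0..}. borel)"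
      by (rule measurable_vimage_algebra1) (auto simp: space_PiM)
    from measurable_compose[OF this measurable_component_singleton[of a]]
    show "\<beta> a \<in> borel_measurable (vimage_algebra (space M) (\<lambda>\<omega>. \<lambda>t\<in>{0..}. \<beta> t \<omega>) (\<Pi>\<^sub>M t\<in>{0..}. borel))"
      using a by simp
  qed
  have Am: "winding_clock r t \<in> borel_measurable M"
    using iv[of 0] indep_var_rv1 by blast
  note tc = time_change_char[OF M bm Am winding_clock_props(3)[OF M r] iv]
  show "CH1_winding r \<beta> t \<in> borel_measurable M"
    "(\<integral>\<omega>. iexp (u * CH1_winding r \<beta> t \<omega>) \<partial>M) = (\<integral>\<omega>. exp (- (u\<^sup>2 / 2 * winding_clock r t \<omega>)) \<partial>M)"
    using tc unfolding CH1_winding_def by auto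
qed

lemma winding_clock_measurable:
  assumes M: "prob_space M" and r: "hyperbolic_jacobi_diffusion M r0 r" and t: "0 \<le> t"
  shows "winding_clock r t \<in> borel_measurable M"
proof -
  interpret L: log_martingale_problem M "natural_filtration M r" "\<lambda>t \<omega>. ln (coth (r t \<omega>))" "ln (coth r0)"
    by (rule jacobi_log_martingale_problem[OF M r])
  have "(\<lambda>\<omega>. integral {0..t} (\<lambda>s. 1 * clock_rate (ln (coth (r s \<omega>))))) \<in> borel_measurable M"
    by (rule L.path_integral_measurable[OF clock_rate_continuous _ t]) simp
  then show ?thesis
    by (subst measurable_cong[of _ _ "\<lambda>\<omega>. integral {0..t} (\<lambda>s. 1 * clock_rate (ln (coth (r s \<omega>))))"])
      (use winding_clock_props(1)[OF M r _ t] in auto)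
qed

lemma winding_clock_laplace:
  assumes M: "prob_space M" and r: "hyperbolic_jacobi_diffusion M r0 r" and l: "0 < l"
  shows "0 \<le> t \<Longrightarrow> exp (- l * ln (coth r0)) \<le> (\<integral>\<omega>. exp (- (l\<^sup>2 / 2 * winding_clock r t \<omega>)) \<partial>M)"
    and "((\<lambda>t. \<integral>\<omega>. exp (- (l\<^sup>2 / 2 * winding_clock r t \<omega>)) \<partial>M) \<longlongrightarrow> exp (- l * ln (coth r0))) at_top"
proof -
  interpret L: log_martingale_problem M "natural_filtration M r" "\<lambda>t \<omega>. ln (coth (r t \<omega>))" "ln (coth r0)"
    by (rule jacobi_log_martingale_problem[OF M r])
  have eq: "(\<integral>\<omega>. exp (- (l\<^sup>2 / 2 * winding_clock r t \<omega>)) \<partial>M)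
    = L.expectation (\<lambda>\<omega>. L.discount (\<lambda>x. l\<^sup>2 / 2 * clock_rate x) t \<omega>)" if t: "0 \<le> t" for t
  proof (rule Bochner_Integration.integral_cong[OF refl])
    fix \<omega> assume "\<omega> \<in> space M"
    from winding_clock_props(1)[OF M r this t]
    show "exp (- (l\<^sup>2 / 2 * winding_clock r t \<omega>)) = L.discount (\<lambda>x. l\<^sup>2 / 2 * clock_rate x) t \<omega>"
      unfolding L.discount_def by (simp only: integral_mult_right)
  qed
  show "exp (- l * ln (coth r0)) \<le> (\<integral>\<omega>. exp (- (l\<^sup>2 / 2 * winding_clock r t \<omega>)) \<partial>M)" if "0 \<le> t"
    using L.laplace_lower[OF l that] eq[OF that] by simp
  show "((\<lambda>t. \<integral>\<omega>. exp (- (l\<^sup>2 / 2 * winding_clock r t \<omega>)) \<partial>M) \<longlongrightarrow> exp (- l * ln (coth r0))) at_top"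
  proof (rule Lim_transform_eventually[OF L.laplace_limit[OF l]])
    show "\<forall>\<^sub>F t in at_top. L.expectation (\<lambda>\<omega>. L.discount (\<lambda>x. l\<^sup>2 / 2 * clock_rate x) t \<omega>)
      = (\<integral>\<omega>. exp (- (l\<^sup>2 / 2 * winding_clock r t \<omega>)) \<partial>M)"
      using eventually_ge_at_top[of 0] by eventually_elim (use eq in simp)
  qed
qed

lemma winding_char_tendsto:
  assumes M: "prob_space M" and r: "hyperbolic_jacobi_diffusion M r0 r"
    and bm: "standard_brownian_motion M \<beta>" and ind: "independent_processes M r \<beta>"
  shows "((\<lambda>t. \<integral>\<omega>. iexp (u * CH1_winding r \<beta> t \<omega>) \<partial>M) \<longlongrightarrow> of_real (exp (- (ln (coth r0) * \<bar>u\<bar>)))) at_top"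
proof (cases "u = 0")
  case True
  interpret prob_space M by fact
  show ?thesis using True by (simp add: prob_space)
next
  case False
  from tendsto_of_real[OF winding_clock_laplace(2)[OF M r, of "\<bar>u\<bar>"]]
  show ?thesis using False unfolding winding_char(2)[OF M r bm ind] by (simp add: mult.commute)
qed

text \<open>The discount factors \<open>exp (- l\<^sup>2 A n / 2)\<close> decrease to \<open>0\<close> where \<open>A\<close> is unbounded and are at most \<open>1\<close>
  elsewhere, so the limit of their expectations is at most the probability of the event \<open>G\<close> that \<open>A\<close> is
  bounded. By the lower bound for the Laplace transform this probability is at least
  \<open>exp (- l ln (coth r0))\<close> for every \<open>l > 0\<close>, hence \<open>1\<close>.\<close>

lemma winding_clock_AE_convergent:
  assumes M: "prob_space M" and r: "hyperbolic_jacobi_diffusion M r0 r"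
  shows "AE \<omega> in M. convergent (\<lambda>n. winding_clock r (real n) \<omega>)"
proof -
  interpret prob_space M by fact
  define A where "A = (\<lambda>(n::nat) \<omega>. winding_clock r (real n) \<omega>)"
  have Am [measurable]: "A n \<in> borel_measurable M" for n
    unfolding A_def using winding_clock_measurable[OF M r] by simp
  have A0: "0 \<le> A n \<omega>" for n \<omega> unfolding A_def by (rule winding_clock_props(3)[OF M r])
  have Amono: "mono (\<lambda>n. A n \<omega>)" if "\<omega> \<in> space M" for \<omega>
    unfolding A_def using winding_clock_props(2)[OF M r that] by (intro monoI) simp
  define G where "G = {\<omega>\<in>space M. \<exists>K::nat. \<forall>n. A n \<omega> \<le> real K}"
  have Gm [measurable]: "G \<in> sets M" unfolding G_def by measurable
  have lower: "exp (- l * ln (coth r0)) \<le> prob G" if l: "0 < l" for l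
  proof -
    define d where "d = (\<lambda>n \<omega>. exp (- (l\<^sup>2 / 2 * A n \<omega>)))"
    have dm [measurable]: "d n \<in> borel_measurable M" for n unfolding d_def by measurable
    have d01: "0 \<le> d n \<omega>" "d n \<omega> \<le> 1" for n \<omega> using A0[of n \<omega>] by (auto simp: d_def)
    have ddec: "decseq (\<lambda>n. d n \<omega>)" if "\<omega> \<in> space M" for \<omega>
      unfolding d_def decseq_def using Amono[OF that] by (auto simp: mono_def intro!: mult_left_mono)
    have dconv: "convergent (\<lambda>n. d n \<omega>)" if "\<omega> \<in> space M" for \<omega>
      using decseq_convergent[OF ddec[OF that], of 0] d01 unfolding convergent_def by metis
    have d_lim: "lim (\<lambda>n. d n \<omega>) \<le> indicator G \<omega>" if \<omega>: "\<omega> \<in> space M" for \<omega>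
    proof (cases "\<omega> \<in> G")
      case True
      then show ?thesis using lim_le[OF dconv[OF \<omega>] d01(2)] by simp
    next
      case False
      have "filterlim (\<lambda>n. A n \<omega>) at_top sequentially"
        unfolding filterlim_at_top
      proof
        fix Z :: real
        obtain K :: nat where K: "Z \<le> real K" using real_arch_simple by blast
        obtain n where n: "real K < A n \<omega>" using False \<omega> by (auto simp: G_def not_le)
        show "\<forall>\<^sub>F n in sequentially. Z \<le> A n \<omega>"
        proof (rule eventually_sequentiallyI[of n])
          fix m assume "n \<le> m"
          then have "A n \<omega> \<le> A m \<omega>" using Amono[OF \<omega>] by (simp add: mono_def)
          then show "Z \<le> A m \<omega>" using K n by linarith
        qed
      qed
      then have "filterlim (\<lambda>n. l\<^sup>2 / 2 * A n \<omega>) at_top sequentially"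
        by (rule filterlim_tendsto_pos_mult_at_top[OF tendsto_const, rotated]) (use l in simp)
      then have "filterlim (\<lambda>n. - (l\<^sup>2 / 2 * A n \<omega>)) at_bot sequentially"
        unfolding filterlim_uminus_at_bot by simp
      from filterlim_compose[OF exp_at_bot this]
      have "(\<lambda>n. d n \<omega>) \<longlonglongrightarrow> 0" by (simp add: d_def)
      then show ?thesis using False by (simp add: limI)
    qed
    have limm [measurable]: "(\<lambda>\<omega>. lim (\<lambda>n. d n \<omega>)) \<in> borel_measurable M"
      by (rule borel_measurable_lim_metric) (rule dm)
    have "(\<lambda>n. expectation (d n)) \<longlonglongrightarrow> expectation (\<lambda>\<omega>. lim (\<lambda>n. d n \<omega>))"
    proof (rule integral_dominated_convergence[where w = "\<lambda>_. 1"])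
      show "AE \<omega> in M. (\<lambda>n. d n \<omega>) \<longlonglongrightarrow> lim (\<lambda>n. d n \<omega>)"
        using dconv by (intro AE_I2) (simp add: convergent_LIMSEQ_iff)
      show "AE \<omega> in M. norm (d n \<omega>) \<le> 1" for n using d01 by simp
    qed auto
    then have "exp (- l * ln (coth r0)) \<le> expectation (\<lambda>\<omega>. lim (\<lambda>n. d n \<omega>))"
      by (rule LIMSEQ_le_const)
        (use winding_clock_laplace(1)[OF M r l] in \<open>auto simp: d_def A_def\<close>)
    also have "\<dots> \<le> expectation (\<lambda>\<omega>. indicator G \<omega>)"
    proof (rule integral_mono)
      show "integrable M (\<lambda>\<omega>. lim (\<lambda>n. d n \<omega>))"
      proof (rule integrable_const_bound[of _ 1])
        show "AE \<omega> in M. norm (lim (\<lambda>n. d n \<omega>)) \<le> 1"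
        proof (rule AE_I2)
          fix \<omega> assume \<omega>: "\<omega> \<in> space M"
          have "0 \<le> lim (\<lambda>n. d n \<omega>)"
            using LIMSEQ_le_const[OF convergent_LIMSEQ_iff[THEN iffD1, OF dconv[OF \<omega>]]] d01(1) by blast
          moreover have "lim (\<lambda>n. d n \<omega>) \<le> 1"
            using d_lim[OF \<omega>] by (rule order_trans) (simp add: indicator_def)
          ultimately show "norm (lim (\<lambda>n. d n \<omega>)) \<le> 1" by simp
        qed
      qed (rule limm)
      show "integrable M (\<lambda>\<omega>. indicator G \<omega> :: real)"
        by (rule integrable_const_bound[of _ 1]) auto
    qed (use d_lim in auto)
    finally show ?thesis by simp
  qed
  have "(\<lambda>n. exp (- inverse (real (Suc n)) * ln (coth r0))) \<longlonglongrightarrow> exp (- 0 * ln (coth r0))"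
    by (intro tendsto_exp tendsto_mult tendsto_minus LIMSEQ_inverse_real_of_nat tendsto_const)
  then have "1 \<le> prob G"
    by (intro LIMSEQ_le_const2[of _ 1]) (use lower in auto)
  then have "prob G = 1" using prob_le_1[of G] by linarith
  then have "AE \<omega> in M. \<omega> \<in> G" using prob_eq_1[OF Gm] by simp
  then show ?thesis
  proof eventually_elim
    case (elim \<omega>)
    then obtain K :: nat where K: "\<And>n. A n \<omega> \<le> real K" and \<omega>: "\<omega> \<in> space M" by (auto simp: G_def)
    have "incseq (\<lambda>n. A n \<omega>)" using Amono[OF \<omega>] by (simp add: incseq_def mono_def)
    from incseq_convergent[OF this, of "real K"] K show ?case
      unfolding A_def convergent_def by blast
  qed
qed

text \<open>The paths of \<open>\<beta>\<close> are continuous at the limit of the clock.\<close>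

lemma winding_AE_convergent:
  assumes M: "prob_space M" and r: "hyperbolic_jacobi_diffusion M r0 r"
    and bm: "standard_brownian_motion M \<beta>"
  shows "AE \<omega> in M. convergent (\<lambda>n. CH1_winding r \<beta> (real n) \<omega>)"
  using winding_clock_AE_convergent[OF M r] AE_space
proof eventually_elim
  case (elim \<omega>)
  then obtain L where L: "(\<lambda>n. winding_clock r (real n) \<omega>) \<longlonglongrightarrow> L" by (auto simp: convergent_def)
  have c0: "0 \<le> winding_clock r t \<omega>" for t by (rule winding_clock_props(3)[OF M r])
  have "0 \<le> L" using LIMSEQ_le_const[OF L] c0 by blast
  moreover have "continuous_on {0..} (\<lambda>t. \<beta> t \<omega>)"
    using bm elim(2) by (simp add: standard_brownian_motion_def continuous_process_def)
  ultimately have "(\<lambda>n. CH1_winding r \<beta> (real n) \<omega>) \<longlonglongrightarrow> \<beta> L \<omega>"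
    unfolding CH1_winding_def using c0 by (intro continuous_on_tendsto_compose[OF _ L]) auto
  then show ?case by (rule convergentI)
qed

lemma char_distr:
  assumes "X \<in> borel_measurable M"
  shows "char (distr M borel X) u = (\<integral>\<omega>. iexp (u * X \<omega>) \<partial>M)"
  unfolding char_def using assms by (subst integral_distr) auto

lemma cauchy_distribution_eqI:
  assumes "real_distribution \<mu>" "\<And>u. char \<mu> u = of_real (exp (- (a * \<bar>u\<bar>)))"
  shows "cauchy_distribution a = \<mu>"
  unfolding cauchy_distribution_def
proof (rule the_equality)
  fix \<nu> :: "real measure"
  assume \<nu>: "real_distribution \<nu> \<and> (\<forall>u. char \<nu> u = of_real (exp (- (a * \<bar>u\<bar>))))"
  then have "char \<nu> = char \<mu>" using assms(2) by auto
  then show "\<nu> = \<mu>" using \<nu> assms(1) by (intro Levy_uniqueness) auto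
qed (use assms in auto)

theorem theorem4p2:
  fixes M :: "'a measure"
    and r \<beta> :: "real \<Rightarrow> 'a \<Rightarrow> real"
    and r0 :: real
  assumes "prob_space M"
    and "0 < r0"
    and "hyperbolic_jacobi_diffusion M r0 r"
    and "standard_brownian_motion M \<beta>"
    and "independent_processes M r \<beta>"
  shows "weak_conv_at_top (\<lambda>t. distr M borel (CH1_winding r \<beta> t))
           (cauchy_distribution (ln (coth r0)))"
proof -
  interpret prob_space M by fact
  note M = assms(1) and r = assms(3) and bm = assms(4) and ind = assms(5)
  have \<phi>m [measurable]: "CH1_winding r \<beta> t \<in> borel_measurable M" for t
    by (rule winding_char(1)[OF M r bm ind])
  note lim = winding_char_tendsto[OF M r bm ind]
  \<comment> \<open>The almost sure limit realizes the Cauchy law; off the event of convergence \<open>lim\<close> is some measurable choice.\<close>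
  define X where "X = (\<lambda>\<omega>. lim (\<lambda>n. CH1_winding r \<beta> (real n) \<omega>))"
  have Xm [measurable]: "X \<in> borel_measurable M"
    unfolding X_def by (rule borel_measurable_lim_metric) (rule \<phi>m)
  have charX: "char (distr M borel X) u = of_real (exp (- (ln (coth r0) * \<bar>u\<bar>)))" for u
  proof (rule LIMSEQ_unique)
    show "(\<lambda>n. \<integral>\<omega>. iexp (u * CH1_winding r \<beta> (real n) \<omega>) \<partial>M) \<longlonglongrightarrow> of_real (exp (- (ln (coth r0) * \<bar>u\<bar>)))"
      by (rule filterlim_compose[OF lim filterlim_real_sequentially])
    show "(\<lambda>n. \<integral>\<omega>. iexp (u * CH1_winding r \<beta> (real n) \<omega>) \<partial>M) \<longlonglongrightarrow> char (distr M borel X) u"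
      unfolding char_distr[OF Xm]
    proof (rule integral_dominated_convergence[where w = "\<lambda>_. 1"])
      show "AE \<omega> in M. (\<lambda>n. iexp (u * CH1_winding r \<beta> (real n) \<omega>)) \<longlonglongrightarrow> iexp (u * X \<omega>)"
        using winding_AE_convergent[OF M r bm]
      proof eventually_elim
        case (elim \<omega>)
        then have "(\<lambda>n. CH1_winding r \<beta> (real n) \<omega>) \<longlonglongrightarrow> X \<omega>"
          by (simp add: X_def convergent_LIMSEQ_iff)
        then show ?case by (intro tendsto_intros)
      qed
    qed auto
  qed
  have cauchy: "cauchy_distribution (ln (coth r0)) = distr M borel X"
    using real_distribution_distr[OF Xm] charX by (rule cauchy_distribution_eqI)
  show ?thesis
    unfolding weak_conv_at_top_iff_sequences cauchy
  proof (intro allI impI)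
    fix T :: "nat \<Rightarrow> real" assume T: "filterlim T at_top sequentially"
    show "weak_conv_m (\<lambda>n. distr M borel (CH1_winding r \<beta> (T n))) (distr M borel X)"
    proof (rule levy_continuity)
      fix u
      show "(\<lambda>n. char (distr M borel (CH1_winding r \<beta> (T n))) u) \<longlonglongrightarrow> char (distr M borel X) u"
        unfolding charX unfolding char_distr[OF \<phi>m] by (rule filterlim_compose[OF lim T])
    qed auto
  qed
qed

end
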